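(* Fix an integer $d\ge1$. For every $\varepsilon\in(0,d^{-d/2})$ there exists a constant $c=c(\varepsilon,d)>0$ such that, with probability at least $1-\varepsilon$, the stretch factor of two uniformly chosen (distinct) vertices $u$ and $v$ of the $d$-NN tree $G_n$ is at most $c$.
   Context: Let $\mathbb T^d_n$ be the $d$-dimensional torus of volume $n$ (that is, $\mathbb R^d/(n^{1/d}\mathbb Z)^d$) with the metric inherited from the Euclidean metric. The $d$-NN tree $G_n$: vertices $0,1,\dots,n-1$ arrive one by one, vertex $i$ being placed at a uniformly random point of $\mathbb T^d_n$, independently of all others; each vertex $i\ge 1$ is connected upon arrival by an edge to the closest vertex among $\{0,\dots,i-1\}$ in the torus metric (ties have probability $0$). The stretch factor of two vertices $u,v$ of $G_n$ is the sum of the Euclidean (torus) lengths of the edges on the path in $G_n$ between $u$ and $v$, divided by the Euclidean (torus) distance between the positions of $u$ and $v$. The constant $c$ does not depend on $n$. *)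

theory Defs
  imports "HOL-Probability.Probability"
begin

text \<open>
  The dimension is \<open>d = CARD('d)\<close>. Points of the torus
  \<open>R^d / (L Z)^d\<close>, \<open>L = n^(1/d)\<close>, are represented in the half-open fundamental cube \<open>[0, L)^d\<close>.
\<close>

definition torus_side :: "'d::finite itself \<Rightarrow> nat \<Rightarrow> real" where
  "torus_side _ n = real n powr (1 / real CARD('d))"

definition torus_cube :: "nat \<Rightarrow> (real ^ 'd::finite) set" where
  "torus_cube n = {x. \<forall>i. 0 \<le> x $ i \<and> x $ i < torus_side TYPE('d) n}"

text \<open>The quotient metric: the Euclidean distance minimised over all lattice translates.\<close>

definition torus_dist :: "nat \<Rightarrow> real ^ 'd::finite \<Rightarrow> real ^ 'd \<Rightarrow> real" where
  "torus_dist n x y =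
     (INF k :: int ^ 'd. dist x (y + torus_side TYPE('d) n *\<^sub>R (\<chi> i. of_int (k $ i))))"

text \<open>
  \<open>x i\<close> is the position of vertex \<open>i\<close>. Ties, which occur with probability 0, are broken in
  favour of the oldest vertex, so that the graph is always a well-defined tree.
\<close>

definition nn_parent :: "nat \<Rightarrow> (nat \<Rightarrow> real ^ 'd::finite) \<Rightarrow> nat \<Rightarrow> nat" where
  "nn_parent n x i =
     (LEAST j. j < i \<and> (\<forall>k<i. torus_dist n (x i) (x j) \<le> torus_dist n (x i) (x k)))"

definition nn_edges :: "nat \<Rightarrow> (nat \<Rightarrow> real ^ 'd::finite) \<Rightarrow> nat set set" where
  "nn_edges n x = {{i, nn_parent n x i} | i. 1 \<le> i \<and> i < n}"

definition is_path :: "'v set set \<Rightarrow> 'v \<Rightarrow> 'v \<Rightarrow> 'v list \<Rightarrow> bool" where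
  "is_path E u v p \<longleftrightarrow>
     p \<noteq> [] \<and> hd p = u \<and> last p = v \<and> distinct p \<and> successively (\<lambda>a b. {a, b} \<in> E) p"

text \<open>Unique for \<open>u, v < n\<close>, because the graph is a tree on \<open>{..<n}\<close>.\<close>

definition nn_path :: "nat \<Rightarrow> (nat \<Rightarrow> real ^ 'd::finite) \<Rightarrow> nat \<Rightarrow> nat \<Rightarrow> nat list" where
  "nn_path n x u v = (THE p. is_path (nn_edges n x) u v p)"

definition path_length :: "nat \<Rightarrow> (nat \<Rightarrow> real ^ 'd::finite) \<Rightarrow> nat list \<Rightarrow> real" where
  "path_length n x p = (\<Sum>k<length p - 1. torus_dist n (x (p ! k)) (x (p ! Suc k)))"

text \<open>
  If \<open>u \<noteq> v\<close> sit at the same point (probability 0) the value is 0 by the convention for division.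
\<close>

definition stretch_factor :: "nat \<Rightarrow> (nat \<Rightarrow> real ^ 'd::finite) \<Rightarrow> nat \<Rightarrow> nat \<Rightarrow> real" where
  "stretch_factor n x u v = path_length n x (nn_path n x u v) / torus_dist n (x u) (x v)"

text \<open>
  Joint law of the \<open>n\<close> independent uniform positions and, independently of them, a uniformly
  chosen ordered pair of distinct vertices.
\<close>

definition vertex_pairs :: "nat \<Rightarrow> (nat \<times> nat) set" where
  "vertex_pairs n = {(u, v). u < n \<and> v < n \<and> u \<noteq> v}"

definition nn_model :: "nat \<Rightarrow> ((nat \<Rightarrow> real ^ 'd::finite) \<times> nat \<times> nat) measure" where
  "nn_model n =
     (\<Pi>\<^sub>M i\<in>{..<n}. uniform_measure lborel (torus_cube n))
       \<Otimes>\<^sub>M uniform_count_measure (vertex_pairs n)"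

end

theory Submission
  imports Defs "HOL-Real_Asymp.Real_Asymp"
begin

text \<open>
  Let \<open>L\<close> be the side of the torus. Two given vertices are at distance less than \<open>L / m\<close> with
  probability at most \<open>3 / m\<close>, so it suffices to show that the path from a given vertex \<open>u\<close> to the
  root has expected length \<open>O(L)\<close>. Follow the chain of parents of \<open>u\<close> until its label drops to at
  most \<open>j\<close>. The points \<open>0, \<dots>, j\<close> enter the chain so far only as a set, hence by exchangeability it
  arrives at each of them with the same probability, and \<open>j\<close> is an ancestor of \<open>u\<close> with probability
  \<open>1 / (j + 1)\<close>. Outside an event of probability at most \<open>exp (- sqrt j)\<close>, one of the points \<open>0, \<dots>, j - 1\<close> lies in
  the same cell as point \<open>j\<close> of a grid of mesh about \<open>L / j powr (1 / (2 * d))\<close>, which bounds the edge from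
  \<open>j\<close> to its parent. The resulting series \<open>\<Sum>\<^sub>j 1 / (j + 1) * j powr (- 1 / (2 * d)) + exp (- sqrt j)\<close>
  converges.
\<close>

section \<open>The torus metric and the uniform law\<close>

abbreviation lattice_shift :: "nat \<Rightarrow> int ^ 'd \<Rightarrow> real ^ 'd::finite" where
  "lattice_shift n k \<equiv> torus_side TYPE('d) n *\<^sub>R (\<chi> i. of_int (k $ i))"

lemma torus_side_pos: "1 \<le> n \<Longrightarrow> 0 < torus_side TYPE('d::finite) n"
  by (simp add: torus_side_def)

lemma torus_dist_nonneg: "0 \<le> torus_dist n x y"
  unfolding torus_dist_def by (intro cINF_greatest) auto

lemma bdd_below_torus_dist:
  "bdd_below (range (\<lambda>k. dist x (y + lattice_shift n k)))"
  by (rule bdd_belowI[of _ 0]) auto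

lemma torus_dist_le_shift: "torus_dist n x y \<le> dist x (y + lattice_shift n k)"
  unfolding torus_dist_def by (intro cINF_lower bdd_below_torus_dist) auto

lemma torus_dist_le_dist:
  fixes x y :: "real ^ 'd::finite"
  shows "torus_dist n x y \<le> dist x y"
proof -
  have "y + lattice_shift n 0 = y" by (simp add: vec_eq_iff)
  then show ?thesis using torus_dist_le_shift[of n x y 0] by metis
qed

lemma torus_dist_commute:
  fixes x y :: "real ^ 'd::finite"
  shows "torus_dist n x y = torus_dist n y x"
proof -
  have *: "torus_dist n x y \<le> torus_dist n y x" for x y :: "real ^ 'd"
    unfolding torus_dist_def[of n y x]
  proof (rule cINF_greatest)
    fix k :: "int ^ 'd"
    have "lattice_shift n (- k) = - lattice_shift n k" by (simp add: vec_eq_iff)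
    then have "dist x (y + lattice_shift n (- k)) = dist y (x + lattice_shift n k)"
      by (simp add: dist_norm norm_minus_commute algebra_simps)
    then show "torus_dist n x y \<le> dist y (x + lattice_shift n k)"
      using torus_dist_le_shift[of n x y "- k"] by simp
  qed auto
  show ?thesis by (intro antisym *)
qed

lemma torus_dist_measurable [measurable]:
  assumes [measurable]: "f \<in> borel_measurable M" "g \<in> borel_measurable M"
  shows "(\<lambda>\<omega>. torus_dist n (f \<omega>) (g \<omega> :: real ^ 'd::finite)) \<in> borel_measurable M"
  unfolding torus_dist_def
proof (rule borel_measurable_cINF)
  show "bdd_below ((\<lambda>k. dist (f x) (g x + lattice_shift n k)) ` UNIV)" for x
    by (rule bdd_below_torus_dist)
qed (auto intro: countableI_type)

text \<open>For points of the cube every coordinate difference is at most the side in absolute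
  value, so replacing each entry of a lattice shift by its sign does not increase the distance. The
  infimum is therefore a minimum over the finitely many shifts with entries -1, 0, 1.\<close>

lemma torus_dist_attained:
  fixes x y :: "real ^ 'd::finite"
  assumes "x \<in> torus_cube n" "y \<in> torus_cube n"
  shows "\<exists>k. torus_dist n x y = dist x (y + lattice_shift n k)"
proof -
  let ?L = "torus_side TYPE('d) n"
  let ?f = "\<lambda>k. dist x (y + lattice_shift n k)"
  let ?S = "{k :: int ^ 'd. \<forall>i. k $ i \<in> {-1, 0, 1}}"
  have "?S \<subseteq> vec_lambda ` (UNIV \<rightarrow>\<^sub>E {-1, 0, 1})"
  proof
    fix k assume "k \<in> ?S"
    then show "k \<in> vec_lambda ` (UNIV \<rightarrow>\<^sub>E {-1, 0, 1})"
      by (intro image_eqI[of _ _ "($) k"]) (auto simp: vec_nth_inverse)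
  qed
  then have fin: "finite ?S" by (rule finite_subset) (intro finite_imageI finite_PiE, auto)
  have ne: "?S \<noteq> {}" by (auto intro!: exI[of _ 0])
  have L0: "0 \<le> ?L" by (simp add: torus_side_def)
  have L: "\<bar>x $ i - y $ i\<bar> \<le> ?L" for i
  proof -
    have "0 \<le> x $ i" "x $ i < ?L" "0 \<le> y $ i" "y $ i < ?L"
      using assms by (auto simp: torus_cube_def)
    then show ?thesis by linarith
  qed
  have red: "\<exists>k'\<in>?S. ?f k' \<le> ?f k" for k
  proof (intro bexI[of _ "\<chi> i. sgn (k $ i)"])
    have "\<bar>t - ?L * of_int (sgn a)\<bar> \<le> \<bar>t - ?L * of_int a\<bar>" if "\<bar>t\<bar> \<le> ?L" for t and a :: int
    proof -
      consider "a = 0" | "1 \<le> a" | "a \<le> -1" by linarith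
      then show ?thesis
      proof cases
        case 2
        then have "?L * 1 \<le> ?L * of_int a" using L0 by (intro mult_left_mono) auto
        then show ?thesis using 2 that by (simp add: sgn_if)
      next
        case 3
        then have "?L * of_int a \<le> ?L * (-1)" using L0 by (intro mult_left_mono) linarith+
        then show ?thesis using 3 that by (simp add: sgn_if)
      qed auto
    qed
    note * = this
    show "?f (\<chi> i. sgn (k $ i)) \<le> ?f k"
      unfolding dist_norm
    proof (rule norm_le_componentwise_cart)
      fix i
      show "norm ((x - (y + lattice_shift n (\<chi> i. sgn (k $ i)))) $ i)
        \<le> norm ((x - (y + lattice_shift n k)) $ i)"
        using *[OF L, of i "k $ i"] by (simp add: diff_diff_eq)
    qed
    show "(\<chi> i. sgn (k $ i)) \<in> ?S" by (auto simp: sgn_if)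
  qed
  define k0 where "k0 = arg_min_on ?f ?S"
  have k0: "?f k0 \<le> ?f k" if "k \<in> ?S" for k
    unfolding k0_def by (rule arg_min_least[OF fin ne that])
  have "?f k0 \<le> torus_dist n x y"
    unfolding torus_dist_def
  proof (rule cINF_greatest)
    fix k
    obtain k' where "k' \<in> ?S" "?f k' \<le> ?f k" using red by blast
    then show "?f k0 \<le> ?f k" using k0[of k'] by linarith
  qed auto
  then show ?thesis using torus_dist_le_shift[of n x y k0] by (intro exI[of _ k0]) auto
qed

section \<open>Volumes of boxes and the uniform law on the cube\<close>

lemma half_open_box_sets:
  "{z :: real ^ 'd::finite. \<forall>i. l i \<le> z $ i \<and> z $ i < u i} \<in> sets borel"
  by measurable

text \<open>The half-open box lies between the open and the closed box, which have the same
  volume.\<close>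

lemma emeasure_lborel_half_open_box:
  fixes l u :: "'d::finite \<Rightarrow> real"
  assumes "\<And>i. l i \<le> u i"
  shows "emeasure lborel {z :: real ^ 'd. \<forall>i. l i \<le> z $ i \<and> z $ i < u i} = (\<Prod>i\<in>UNIV. u i - l i)"
proof -
  let ?l = "vec_lambda l" and ?u = "vec_lambda u"
  let ?H = "{z :: real ^ 'd. \<forall>i. l i \<le> z $ i \<and> z $ i < u i}"
  have le: "?l \<bullet> b \<le> ?u \<bullet> b" if "b \<in> Basis" for b
    using that assms by (auto simp: Basis_vec_def inner_axis)
  have H: "?H \<in> sets lborel" using half_open_box_sets[of l u] by simp
  have c: "emeasure lborel (cbox ?l ?u) = (\<Prod>i\<in>UNIV. u i - l i)"
  proof -
    have "emeasure lborel (cbox ?l ?u) = measure lborel (cbox ?l ?u)"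
      by (intro emeasure_eq_ennreal_measure) (simp add: emeasure_lborel_cbox_eq)
    also have "measure lborel (cbox ?l ?u) = (\<Prod>i\<in>UNIV. u i - l i)"
      using assms by (subst content_cbox_cart) (auto simp: interval_eq_empty_cart not_less)
    finally show ?thesis .
  qed
  have "emeasure lborel (box ?l ?u) = emeasure lborel (cbox ?l ?u)"
    using le by (simp add: emeasure_lborel_box emeasure_lborel_cbox)
  moreover have "emeasure lborel (box ?l ?u) \<le> emeasure lborel ?H"
    using H by (intro emeasure_mono) (auto simp: mem_box_cart less_imp_le)
  moreover have "emeasure lborel ?H \<le> emeasure lborel (cbox ?l ?u)"
    by (intro emeasure_mono) (auto simp: mem_box_cart less_imp_le)
  ultimately show ?thesis using c by auto
qed

definition torus_law :: "nat \<Rightarrow> (real ^ 'd::finite) measure" where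
  "torus_law n = uniform_measure lborel (torus_cube n)"

lemma sets_torus_law [simp, measurable_cong]: "sets (torus_law n) = sets borel"
  by (simp add: torus_law_def)

lemma space_torus_law [simp]: "space (torus_law n) = UNIV"
  by (simp add: torus_law_def)

lemma torus_cube_measurable [measurable]: "torus_cube n \<in> sets (borel :: (real ^ 'd::finite) measure)"
  unfolding torus_cube_def by measurable

lemma emeasure_torus_cube:
  assumes "1 \<le> n"
  shows "emeasure lborel (torus_cube n :: (real ^ 'd::finite) set) =
    torus_side TYPE('d) n ^ CARD('d)"
  using emeasure_lborel_half_open_box[of "\<lambda>_::'d. 0" "\<lambda>_. torus_side TYPE('d) n"] 
    torus_side_pos[OF assms, where ?'d = 'd]
  by (simp add: torus_cube_def)

lemma prob_space_torus_law:
  assumes "1 \<le> n"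
  shows "prob_space (torus_law n :: (real ^ 'd::finite) measure)"
  unfolding torus_law_def
  using emeasure_torus_cube[OF assms, where ?'d = 'd] torus_side_pos[OF assms, where ?'d = 'd]
  by (intro prob_space_uniform_measure) auto

text \<open>With the box measured in units of the side it lies inside the cube, and the factor L ^ d
  of its volume cancels against the volume of the cube.\<close>

lemma measure_torus_law_box:
  fixes l u :: "'d::finite \<Rightarrow> real"
  assumes "1 \<le> n" "\<And>i. 0 \<le> l i" "\<And>i. l i \<le> u i" "\<And>i. u i \<le> 1"
  defines "L \<equiv> torus_side TYPE('d) n"
  shows "measure (torus_law n) {z :: real ^ 'd. \<forall>i. l i * L \<le> z $ i \<and> z $ i < u i * L}
    = (\<Prod>i\<in>UNIV. u i - l i)"
proof -
  let ?H = "{z :: real ^ 'd. \<forall>i. l i * L \<le> z $ i \<and> z $ i < u i * L}"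
  have L: "0 < L" unfolding L_def using assms by (intro torus_side_pos)
  have sub: "?H \<subseteq> torus_cube n"
  proof
    fix z assume z: "z \<in> ?H"
    have "0 \<le> z $ i \<and> z $ i < L" for i
    proof -
      have "0 \<le> l i * L" "u i * L \<le> 1 * L"
        using L assms by (auto intro!: mult_right_mono)
      moreover have "l i * L \<le> z $ i" "z $ i < u i * L" using z by auto
      ultimately show ?thesis by linarith
    qed
    then show "z \<in> torus_cube n" by (simp add: torus_cube_def L_def)
  qed
  have e: "emeasure lborel ?H = (\<Prod>i\<in>UNIV. u i - l i) * L ^ CARD('d)"
    using emeasure_lborel_half_open_box[of "\<lambda>i. l i * L" "\<lambda>i. u i * L"] assms L
    by (simp add: left_diff_distrib[symmetric] prod.distrib)
  have c: "emeasure lborel (torus_cube n :: (real ^ 'd) set) = ennreal (L ^ CARD('d))"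
    unfolding L_def by (rule emeasure_torus_cube[OF assms(1)])
  have "0 \<le> (\<Prod>i\<in>UNIV. u i - l i)" using assms by (intro prod_nonneg) auto
  then have m: "measure lborel ?H = (\<Prod>i\<in>UNIV. u i - l i) * L ^ CARD('d)"
    "measure lborel (torus_cube n :: (real ^ 'd) set) = L ^ CARD('d)"
    using e c L by (auto simp: measure_def intro!: enn2real_ennreal)
  have "measure (torus_law n) ?H =
      measure lborel (torus_cube n \<inter> ?H) / measure lborel (torus_cube n :: (real ^ 'd) set)"
    unfolding torus_law_def
  proof (rule measure_uniform_measure)
    show "?H \<in> sets lborel"
      using half_open_box_sets[of "\<lambda>i. l i * L" "\<lambda>i. u i * L"] by simp
  qed (use c L in auto)
  also have "torus_cube n \<inter> ?H = ?H" using sub by blast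
  finally show ?thesis unfolding m using L by simp
qed

lemma AE_torus_law_cube:
  assumes "1 \<le> n"
  shows "AE z in (torus_law n :: (real ^ 'd::finite) measure). z \<in> torus_cube n"
  unfolding torus_law_def by (rule AE_uniform_measureI) auto

text \<open>Since the torus distance is attained by a lattice translate, the exceptional points of
  the cube lie on countably many spheres of radius \<open>r\<close>, one around each translate of
  \<open>y\<close>, and each sphere is a null set.\<close>

lemma AE_torus_law_neq_torus_dist:
  fixes y :: "real ^ 'd::finite"
  assumes "1 \<le> n" "y \<in> torus_cube n"
  shows "AE z in torus_law n. torus_dist n y z \<noteq> r"
proof -
  have "AE z :: real ^ 'd in lborel. \<forall>k. z \<notin> sphere (y - lattice_shift n k) r"
  proof (subst AE_all_countable, intro allI)
    fix k :: "int ^ 'd"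
    have "negligible (sphere (y - lattice_shift n k) r)" by (rule negligible_sphere)
    then have "sphere (y - lattice_shift n k) r \<in> null_sets lborel"
      by (simp add: negligible_iff_null_sets null_sets_completion_iff)
    then show "AE z in lborel. z \<notin> sphere (y - lattice_shift n k) r"
      by (rule AE_not_in)
  qed
  then have "AE z in lborel. z \<in> torus_cube n \<longrightarrow> torus_dist n y z \<noteq> r"
  proof (rule AE_mp, intro AE_I2 impI notI)
    fix z :: "real ^ 'd"
    assume *: "\<forall>k. z \<notin> sphere (y - lattice_shift n k) r" "z \<in> torus_cube n" "torus_dist n y z = r"
    obtain k where "torus_dist n y z = dist y (z + lattice_shift n k)"
      using torus_dist_attained[OF assms(2) *(2)] by blast
    then have "z \<in> sphere (y - lattice_shift n k) r"
      using * by (auto simp: dist_norm algebra_simps)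
    then show False using * by blast
  qed
  then show ?thesis unfolding torus_law_def by (intro AE_uniform_measureI) auto
qed

section \<open>Paths in the tree\<close>

text \<open>\<open>entry p j u\<close> is the first label \<open>\<le> j\<close> on the chain of parents of \<open>u\<close>, so \<open>j\<close> is an ancestor of \<open>u\<close>
  iff \<open>entry p j u = j\<close>. The guard \<open>u \<le> p u\<close>, void for the parents of the tree, makes the
  recursion terminate.\<close>

function entry :: "(nat \<Rightarrow> nat) \<Rightarrow> nat \<Rightarrow> nat \<Rightarrow> nat" where
  "entry p j u = (if u \<le> j \<or> u \<le> p u then u else entry p j (p u))"
  by pat_completeness auto
termination by (relation "Wellfounded.measure (\<lambda>(p, j, u). u)") auto

declare entry.simps [simp del]

lemma entry_self: "u \<le> j \<Longrightarrow> entry p j u = u"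
  by (simp add: entry.simps)

lemma entry_step: "j < u \<Longrightarrow> p u < u \<Longrightarrow> entry p j u = entry p j (p u)"
  by (subst entry.simps) simp

text \<open>The total weight of the path from \<open>u\<close> to the root when the edge from
  \<open>j\<close> to its parent weighs \<open>l j\<close>. Summing over all labels, with a test for
  being an ancestor, allows expectations to be taken label by label.\<close>

definition climb :: "(nat \<Rightarrow> real) \<Rightarrow> (nat \<Rightarrow> nat) \<Rightarrow> nat \<Rightarrow> real" where
  "climb l p u = (\<Sum>j = 1..u. if entry p j u = j then l j else 0)"

lemma climb_nonneg: "(\<And>j. 0 \<le> l j) \<Longrightarrow> 0 \<le> climb l p u"
  unfolding climb_def by (intro sum_nonneg) auto

lemma climb_step:
  assumes "1 \<le> u" "p u < u"
  shows "climb l p u = l u + climb l p (p u)"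
proof -
  let ?f = "\<lambda>v j. if entry p j v = j then l j else 0"
  have "climb l p u = (\<Sum>j\<in>insert u {1..<u}. ?f u j)"
    unfolding climb_def using assms by (intro sum.cong) auto
  also have "\<dots> = l u + (\<Sum>j\<in>{1..<u}. ?f u j)"
    by (simp add: entry_self)
  \<comment> \<open>Below \<open>u\<close> the chains of \<open>u\<close> and \<open>p u\<close>
    agree. A label strictly between \<open>p u\<close> and \<open>u\<close> is skipped: there the
    entry point of \<open>p u\<close> is \<open>p u\<close> itself, which differs from
    \<open>j\<close>.\<close>
  also have "(\<Sum>j\<in>{1..<u}. ?f u j) = (\<Sum>j\<in>{1..<u}. ?f (p u) j)"
    using assms by (intro sum.cong) (auto simp: entry_step)
  also have "\<dots> = (\<Sum>j\<in>{1..p u}. ?f (p u) j)"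
    using assms by (intro sum.mono_neutral_right) (auto simp: entry_self)
  finally show ?thesis by (simp add: climb_def)
qed

lemma is_path_rev: "is_path E u v q \<Longrightarrow> is_path E v u (rev q)"
  unfolding is_path_def
  by (auto simp: hd_rev last_rev successively_rev insert_commute)

lemma is_path_self: "is_path E u u q \<longleftrightarrow> q = [u]"
  unfolding is_path_def
proof safe
  assume *: "q \<noteq> []" "last q = hd q" "distinct q" "u = hd q"
  then obtain r where r: "q = hd q # r" by (cases q) auto
  have "r = []"
  proof (rule ccontr)
    assume "r \<noteq> []"
    then have "last q \<in> set r" using r by (metis last.simps last_in_set)
    then show False using * r by (metis distinct.simps(2))
  qed
  then show "q = [hd q]" using r by simp
qed auto

text \<open>The largest vertex of a simple path cannot be interior: both of its neighbours would be its
  parent. So from the larger endpoint a path can only go to the parent.\<close>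

lemma is_path_descend:
  fixes p :: "nat \<Rightarrow> nat"
  assumes p: "\<And>i. 1 \<le> i \<Longrightarrow> i < n \<Longrightarrow> p i < i"
    and E: "E = {{i, p i} | i. 1 \<le> i \<and> i < n}"
    and path: "is_path E u v q" and "v < u"
  obtains q' where "q = u # q'" "is_path E (p u) v q'"
proof -
  \<comment> \<open>Parents have smaller labels, so the smaller end of an edge is the parent of the
    larger one.\<close>
  have edge: "a = p M" if "{a, M} \<in> E" "a \<le> M" "a \<noteq> M" for a M :: nat
  proof -
    from that(1) obtain i where i: "{a, M} = {i, p i}" "1 \<le> i" "i < n"
      unfolding E by blast
    with p[of i] that have "i \<noteq> a" by (auto simp: doubleton_eq_iff)
    then show ?thesis using i(1) by (auto simp: doubleton_eq_iff)
  qed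
  define M where "M = Max (set q)"
  from path have q: "q \<noteq> []" "hd q = u" "last q = v" "distinct q"
    "successively (\<lambda>a b. {a, b} \<in> E) q"
    by (auto simp: is_path_def)
  have "M \<in> set q" using q unfolding M_def by (intro Max_in) auto
  then obtain xs ys where s: "q = xs @ M # ys" by (meson split_list)
  have le: "a \<le> M" if "a \<in> set q" for a using that unfolding M_def by (intro Max_ge) auto
  have "u \<le> M" using le q by (metis hd_in_set)
  have "ys \<noteq> []" using s q \<open>u \<le> M\<close> \<open>v < u\<close> by auto
  have e2: "{M, hd ys} \<in> E" using q(5) \<open>ys \<noteq> []\<close> unfolding s
    by (auto simp: successively_append_iff successively_Cons)
  have h: "hd ys = p M"
    using \<open>ys \<noteq> []\<close> e2 le q(4) s by (intro edge) (auto simp: insert_commute)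
  have "xs = []"
  proof (rule ccontr)
    assume "xs \<noteq> []"
    then have "{last xs, M} \<in> E" using q(5) unfolding s
      by (auto simp: successively_append_iff successively_Cons)
    then have "last xs = p M"
      using \<open>xs \<noteq> []\<close> le q(4) s by (intro edge) auto
    then have "last xs = hd ys" using h by simp
    then show False using q(4) \<open>xs \<noteq> []\<close> \<open>ys \<noteq> []\<close> unfolding s
      by (metis Un_iff disjoint_iff distinct_append hd_in_set last_in_set list.set_intros(2))
  qed
  then have "M = u" using s q by simp
  show thesis
  proof
    show "q = u # ys" using s \<open>xs = []\<close> \<open>M = u\<close> by simp
    then show "is_path E (p u) v ys" using q \<open>ys \<noteq> []\<close> h \<open>M = u\<close>
      by (auto simp: is_path_def successively_Cons)
  qed
qed

lemma path_length_Cons: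
  "q \<noteq> [] \<Longrightarrow> path_length n x (a # q) = torus_dist n (x a) (x (hd q)) + path_length n x q"
  unfolding path_length_def
  by (cases q) (simp_all add: sum.lessThan_Suc_shift del: sum.lessThan_Suc)

lemma path_length_snoc:
  "q \<noteq> [] \<Longrightarrow> path_length n x (q @ [a]) = path_length n x q + torus_dist n (x (last q)) (x a)"
proof (induction q)
  case (Cons b q)
  then show ?case
  proof (cases "q = []")
    case True
    then show ?thesis by (simp add: path_length_def)
  next
    case False
    then show ?thesis using Cons by (simp add: path_length_Cons)
  qed
qed simp

lemma path_length_rev: "path_length n x (rev q) = path_length n x q"
proof (induction q)
  case (Cons b q)
  then show ?case
    by (cases "q = []")
      (simp_all add: path_length_Cons path_length_snoc last_rev torus_dist_commute)
qed simp

lemma nn_parent_argmin: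
  assumes "1 \<le> i"
  shows "nn_parent n x i < i \<and>
    (\<forall>k<i. torus_dist n (x i) (x (nn_parent n x i)) \<le> torus_dist n (x i) (x k))"
proof -
  let ?P = "\<lambda>j. j < i \<and> (\<forall>k<i. torus_dist n (x i) (x j) \<le> torus_dist n (x i) (x k))"
  let ?j = "arg_min_on (\<lambda>j. torus_dist n (x i) (x j)) {..<i}"
  have ne: "{..<i} \<noteq> {}" using assms by (auto simp: lessThan_empty_iff)
  have "?P ?j"
    using arg_min_if_finite(1)[OF _ ne] arg_min_least[OF _ ne] by fastforce
  then show ?thesis unfolding nn_parent_def by (rule LeastI)
qed

lemma nn_parent_less: "1 \<le> i \<Longrightarrow> nn_parent n x i < i"
  using nn_parent_argmin by blast

lemma nn_parent_min:
  "k < i \<Longrightarrow> torus_dist n (x i) (x (nn_parent n x i)) \<le> torus_dist n (x i) (x k)"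
  using nn_parent_argmin[of i n x] by auto

definition edge_length :: "nat \<Rightarrow> (nat \<Rightarrow> real ^ 'd::finite) \<Rightarrow> nat \<Rightarrow> real" where
  "edge_length n x i = torus_dist n (x i) (x (nn_parent n x i))"

text \<open>Existence, uniqueness and the length bound are proved together by induction on
  \<open>u + v\<close>, replacing the larger endpoint by its parent. The bound on the labels of
  \<open>q\<close> guarantees that prepending the larger endpoint keeps the path simple. The length
  bound is an inequality because both climbs go on to the root after the path has reached a common
  ancestor.\<close>

lemma nn_path_ex:
  fixes x :: "nat \<Rightarrow> real ^ 'd::finite"
  assumes "u < n" "v < n"
  shows "\<exists>q. (\<forall>q'. is_path (nn_edges n x) u v q' \<longleftrightarrow> q' = q) \<and> set q \<subseteq> {..max u v} \<and>
    path_length n x q \<le> climb (edge_length n x) (nn_parent n x) u +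
      climb (edge_length n x) (nn_parent n x) v"
  (is "\<exists>q. ?P u v q")
  using assms
proof (induction "u + v" arbitrary: u v rule: less_induct)
  case less
  let ?p = "nn_parent n x"
  let ?E = "nn_edges n x"
  \<comment> \<open>Reversing paths reduces the case \<open>u < v\<close> to the case
    \<open>v < u\<close>.\<close>
  have swap: "\<exists>q. ?P a b q" if P: "\<exists>q. ?P b a q" for a b
  proof -
    from P obtain q where q: "?P b a q" by blast
    have "is_path ?E a b q' \<longleftrightarrow> q' = rev q" for q'
      using q is_path_rev[of ?E a b q'] is_path_rev[of ?E b a q] by auto
    then show ?thesis using q
      by (intro exI[of _ "rev q"]) (auto simp: path_length_rev max.commute add.commute)
  qed
  have gt: "\<exists>q. ?P a b q" if "a + b = u + v" "a < n" "b < a" for a b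
  proof -
    have pa: "?p a < a" using that by (intro nn_parent_less) auto
    have "?p a + b < u + v" "?p a < n" "b < n" using that pa by simp_all
    then have "\<exists>q. ?P (?p a) b q" by (rule less.hyps)
    then obtain q where q: "?P (?p a) b q" by blast
    then have qp: "is_path ?E (?p a) b q" by blast
    then have q0: "q \<noteq> []" "hd q = ?p a" by (auto simp: is_path_def)
    have set: "set q \<subseteq> {..<a}"
    proof
      fix c assume "c \<in> set q"
      then have "c \<le> max (?p a) b" using q by auto
      then show "c \<in> {..<a}" using pa that by auto
    qed
    have e: "{a, ?p a} \<in> ?E" using that unfolding nn_edges_def by auto
    have "is_path ?E a b q' \<longleftrightarrow> q' = a # q" for q'
    proof
      assume "is_path ?E a b q'"
      then show "q' = a # q"
        by (rule is_path_descend[where p = ?p and n = n, rotated 2])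
          (use nn_parent_less that q in \<open>auto simp: nn_edges_def\<close>)
    next
      assume "q' = a # q"
      then show "is_path ?E a b q'" using qp e set q0
        by (auto simp: is_path_def successively_Cons)
    qed
    moreover have "path_length n x (a # q) \<le> climb (edge_length n x) ?p a + climb (edge_length n x) ?p b"
      using q that q0 climb_step[of a ?p "edge_length n x"] pa
      by (simp add: path_length_Cons edge_length_def[of _ _ a])
    moreover have "set (a # q) \<subseteq> {..max a b}" using set by auto
    ultimately show ?thesis by blast
  qed
  consider "u = v" | "v < u" | "u < v" by linarith
  then show ?case
  proof cases
    case 1
    have "0 \<le> climb (edge_length n x) ?p v"
      by (intro climb_nonneg) (simp add: edge_length_def torus_dist_nonneg)
    then show ?thesis using 1 by (auto simp: is_path_self path_length_def)
  next
    case 2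
    then show ?thesis by (intro gt less.prems refl)
  next
    case 3
    then have "\<exists>q. ?P v u q" using less.prems by (intro gt) simp_all
    then show ?thesis by (rule swap)
  qed
qed

lemma nn_path_length_le:
  fixes x :: "nat \<Rightarrow> real ^ 'd::finite"
  assumes "u < n" "v < n"
  shows "path_length n x (nn_path n x u v) \<le>
    climb (edge_length n x) (nn_parent n x) u + climb (edge_length n x) (nn_parent n x) v"
proof -
  obtain q where q: "\<And>q'. is_path (nn_edges n x) u v q' \<longleftrightarrow> q' = q"
    "path_length n x q \<le> climb (edge_length n x) (nn_parent n x) u +
      climb (edge_length n x) (nn_parent n x) v"
    using nn_path_ex[OF assms, of x] by blast
  have "nn_path n x u v = q" unfolding nn_path_def by (rule the_equality) (simp_all add: q(1))
  then show ?thesis using q(2) by simp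
qed

section \<open>Grid cells and short distances\<close>

text \<open>The index is a function of the coordinate: equality of functions means a common cell,
  while a single value of the function selects a slab.\<close>

definition grid_cell :: "nat \<Rightarrow> nat \<Rightarrow> real ^ 'd::finite \<Rightarrow> 'd \<Rightarrow> int" where
  "grid_cell n m z i = \<lfloor>z $ i * real m / torus_side TYPE('d) n\<rfloor>"

lemma grid_cell_eq_iff:
  fixes z :: "real ^ 'd::finite"
  assumes "1 \<le> n" "1 \<le> m"
  shows "grid_cell n m z i = a \<longleftrightarrow>
    of_int a / real m * torus_side TYPE('d) n \<le> z $ i \<and>
    z $ i < (of_int a + 1) / real m * torus_side TYPE('d) n"
  using torus_side_pos[OF assms(1), where ?'d = 'd] assms(2)
  by (simp add: grid_cell_def floor_eq_iff field_simps)

lemma grid_cell_bounds: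
  fixes z :: "real ^ 'd::finite"
  assumes "1 \<le> n" "1 \<le> m" "z \<in> torus_cube n"
  shows "grid_cell n m z i \<in> {0..<int m}"
proof -
  have L: "0 < torus_side TYPE('d) n" by (rule torus_side_pos[OF assms(1)])
  have z: "0 \<le> z $ i" "z $ i < torus_side TYPE('d) n" using assms(3) by (auto simp: torus_cube_def)
  have "z $ i * real m < torus_side TYPE('d) n * real m"
    using z assms(2) by (intro mult_strict_right_mono) auto
  then have "z $ i * real m / torus_side TYPE('d) n < of_int (int m)"
    using L by (simp add: field_simps)
  moreover have "0 \<le> z $ i * real m / torus_side TYPE('d) n" using z L by auto
  ultimately show ?thesis by (simp add: grid_cell_def floor_less_iff)
qed

lemma dist_le_same_grid_cell:
  fixes y z :: "real ^ 'd::finite"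
  assumes "1 \<le> n" "1 \<le> m" "grid_cell n m y = grid_cell n m z"
  shows "dist y z \<le> real CARD('d) * torus_side TYPE('d) n / real m"
proof -
  let ?L = "torus_side TYPE('d) n"
  have "\<bar>(y - z) $ i\<bar> \<le> ?L / m" for i
  proof -
    let ?a = "of_int (grid_cell n m z i) / real m * ?L"
    have e: "(of_int (grid_cell n m z i) + 1) / real m * ?L = ?a + ?L / m"
      using assms(2) by (simp add: field_simps)
    have "grid_cell n m y i = grid_cell n m z i" using assms(3) by simp
    then have "?a \<le> y $ i \<and> y $ i < ?a + ?L / m"
      unfolding grid_cell_eq_iff[OF assms(1,2)] e .
    moreover have "?a \<le> z $ i \<and> z $ i < ?a + ?L / m"
      using grid_cell_eq_iff[OF assms(1,2), of z i "grid_cell n m z i"] unfolding e by blast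
    ultimately show ?thesis unfolding vector_minus_component abs_le_iff by linarith
  qed
  then have "(\<Sum>i\<in>UNIV. \<bar>(y - z) $ i\<bar>) \<le> of_nat CARD('d) * (?L / m)"
    by (intro sum_bounded_above) auto
  then show ?thesis using norm_le_l1_cart[of "y - z"] by (simp add: dist_norm)
qed

lemma dist_le_torus_cube:
  fixes y z :: "real ^ 'd::finite"
  assumes "1 \<le> n" "y \<in> torus_cube n" "z \<in> torus_cube n"
  shows "dist y z \<le> real CARD('d) * torus_side TYPE('d) n"
proof -
  \<comment> \<open>The grid with one cell per side has the whole cube as its only cell.\<close>
  have "grid_cell n 1 y i = grid_cell n 1 z i" for i
    using grid_cell_bounds[OF assms(1) _ assms(2), of 1 i] grid_cell_bounds[OF assms(1) _ assms(3), of 1 i]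
    by auto
  then show ?thesis using dist_le_same_grid_cell[OF assms(1), of 1 y z] by auto
qed

lemma grid_cell_measurable [measurable]:
  assumes [measurable]: "f \<in> borel_measurable M"
  shows "(\<lambda>\<omega>. grid_cell n m (f \<omega> :: real ^ 'd::finite) i) \<in> measurable M (count_space UNIV)"
proof -
  have "(\<lambda>z :: real ^ 'd. z $ i) \<in> borel_measurable borel"
    by (intro borel_measurable_continuous_onI continuous_intros)
  then have [measurable]: "(\<lambda>\<omega>. f \<omega> $ i) \<in> borel_measurable M"
    by (rule measurable_compose[OF assms])
  show ?thesis unfolding grid_cell_def by measurable
qed

lemma grid_cell_sets:
  "{z :: real ^ 'd::finite. grid_cell n m z = a} \<in> sets borel"
  unfolding fun_eq_iff by measurable

lemma measure_grid_cell:
  fixes a :: "'d::finite \<Rightarrow> int"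
  assumes "1 \<le> n" "1 \<le> m" "\<And>i. a i \<in> {0..<int m}"
  shows "measure (torus_law n) {z :: real ^ 'd. grid_cell n m z = a} = (1 / m) ^ CARD('d)"
proof -
  have b: "0 \<le> real_of_int (a i)" "real_of_int (a i) + 1 \<le> real m" for i
    using assms(3)[of i] by auto
  have "measure (torus_law n) {z :: real ^ 'd. grid_cell n m z = a} =
    measure (torus_law n) {z :: real ^ 'd. \<forall>i. of_int (a i) / real m * torus_side TYPE('d) n \<le> z $ i
      \<and> z $ i < (of_int (a i) + 1) / real m * torus_side TYPE('d) n}"
    unfolding fun_eq_iff grid_cell_eq_iff[OF assms(1,2)] ..
  also have "\<dots> = (\<Prod>i\<in>UNIV. (of_int (a i) + 1) / real m - of_int (a i) / real m)"
  proof (rule measure_torus_law_box[OF assms(1)])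
    show "0 \<le> real_of_int (a i) / real m" "real_of_int (a i) / real m \<le> (of_int (a i) + 1) / real m"
      "(of_int (a i) + 1) / real m \<le> 1" for i
      using b[of i] assms(2) by (simp_all add: divide_right_mono)
  qed
  also have "\<dots> = (1 / m) ^ CARD('d)"
    by (simp add: add_divide_distrib)
  finally show ?thesis .
qed

text \<open>Closeness of two points is tested below in one coordinate, which already gives a bound
  of order 1 / m. Intersecting with the cube turns the slab into a box with known measure.\<close>

definition slab :: "nat \<Rightarrow> nat \<Rightarrow> 'd \<Rightarrow> int \<Rightarrow> (real ^ 'd::finite) set" where
  "slab n m i0 a = {z \<in> torus_cube n. grid_cell n m z i0 = a}"

lemma slab_measurable [measurable]: "slab n m i0 a \<in> sets (borel :: (real ^ 'd::finite) measure)"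
proof -
  have "{z :: real ^ 'd. grid_cell n m z i0 = a} \<in> sets borel"
    by measurable
  moreover have "slab n m i0 a = torus_cube n \<inter> {z :: real ^ 'd. grid_cell n m z i0 = a}"
    by (auto simp: slab_def)
  ultimately show ?thesis by (auto intro: sets.Int torus_cube_measurable)
qed

lemma measure_slab:
  fixes i0 :: "'d::finite"
  assumes "1 \<le> n" "1 \<le> m" "a \<in> {0..<int m}"
  shows "measure (torus_law n) (slab n m i0 a) = 1 / m"
proof -
  let ?l = "\<lambda>i. if i = i0 then of_int a / real m else 0"
  let ?u = "\<lambda>i. if i = i0 then (of_int a + 1) / real m else 1"
  let ?L = "torus_side TYPE('d) n"
  have b: "0 \<le> real_of_int a" "real_of_int a + 1 \<le> real m"
    using assms(3) by auto
  have L: "0 < ?L" by (rule torus_side_pos[OF assms(1)])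
  have "0 \<le> of_int a / real m * ?L" using b L by simp
  moreover have "(of_int a + 1) / real m * ?L \<le> 1 * ?L"
    using b L assms(2) by (intro mult_right_mono) auto
  ultimately have bd: "0 \<le> of_int a / real m * ?L" "(of_int a + 1) / real m * ?L \<le> ?L"
    by simp_all
  have "slab n m i0 a = {z :: real ^ 'd. \<forall>i. ?l i * ?L \<le> z $ i \<and> z $ i < ?u i * ?L}"
  proof (intro set_eqI iffI)
    fix z :: "real ^ 'd"
    assume "z \<in> slab n m i0 a"
    then show "z \<in> {z. \<forall>i. ?l i * ?L \<le> z $ i \<and> z $ i < ?u i * ?L}"
      by (auto simp: slab_def torus_cube_def grid_cell_eq_iff[OF assms(1,2)])
  next
    fix z :: "real ^ 'd"
    assume z: "z \<in> {z. \<forall>i. ?l i * ?L \<le> z $ i \<and> z $ i < ?u i * ?L}"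
    have i0: "of_int a / real m * ?L \<le> z $ i0" "z $ i0 < (of_int a + 1) / real m * ?L"
      using z by (auto dest!: spec[of _ i0])
    have "0 \<le> z $ i \<and> z $ i < ?L" for i
    proof (cases "i = i0")
      case True
      then show ?thesis using i0 bd by auto
    next
      case False
      then show ?thesis using z by (auto dest!: spec[of _ i])
    qed
    then show "z \<in> slab n m i0 a"
      using i0 by (simp add: slab_def torus_cube_def grid_cell_eq_iff[OF assms(1,2)])
  qed
  also have "measure (torus_law n) \<dots> = (\<Prod>i\<in>UNIV. ?u i - ?l i)"
  proof (rule measure_torus_law_box[OF assms(1)])
    have "0 \<le> of_int a / real m" "of_int a / real m \<le> (of_int a + 1) / real m"
      "(of_int a + 1) / real m \<le> 1"
      using b assms(2) by (simp_all add: divide_right_mono)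
    then show "0 \<le> ?l i" "?l i \<le> ?u i" "?u i \<le> 1" for i by simp_all
  qed
  also have "\<dots> = (\<Prod>i\<in>UNIV. if i = i0 then 1 / m else 1)"
    by (intro prod.cong) (auto simp: add_divide_distrib)
  also have "\<dots> = 1 / m" by simp
  finally show ?thesis .
qed

section \<open>The joint law of the positions and isolated grid cells\<close>

definition nn_points :: "nat \<Rightarrow> (nat \<Rightarrow> real ^ 'd::finite) measure" where
  "nn_points n = (\<Pi>\<^sub>M i\<in>{..<n}. torus_law n)"

lemma finite_product_prob_space_torus_law:
  assumes "1 \<le> n"
  shows "finite_product_prob_space (\<lambda>_. torus_law n :: (real ^ 'd::finite) measure) {..<n}"
proof -
  interpret prob_space "torus_law n :: (real ^ 'd) measure" by (rule prob_space_torus_law[OF assms])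
  show ?thesis by unfold_locales auto
qed

lemma prob_space_nn_points:
  assumes "1 \<le> n" shows "prob_space (nn_points n :: (nat \<Rightarrow> real ^ 'd::finite) measure)"
  unfolding nn_points_def using prob_space_torus_law[OF assms] by (intro prob_space_PiM) auto

lemma measure_nn_points_PiE:
  assumes "1 \<le> n" "\<And>i. i < n \<Longrightarrow> X i \<in> sets borel"
  shows "measure (nn_points n) (Pi\<^sub>E {..<n} X) = (\<Prod>i<n. measure (torus_law n) (X i :: (real ^ 'd::finite) set))"
proof -
  interpret finite_product_prob_space "\<lambda>_. torus_law n :: (real ^ 'd) measure" "{..<n}"
    by (rule finite_product_prob_space_torus_law[OF assms(1)])
  show ?thesis unfolding nn_points_def using assms(2) by (intro prob_times) auto
qed

lemma sets_nn_points_PiE: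
  assumes "\<And>i. i < n \<Longrightarrow> X i \<in> sets borel"
  shows "Pi\<^sub>E {..<n} X \<in> sets (nn_points n :: (nat \<Rightarrow> real ^ 'd::finite) measure)"
  unfolding nn_points_def using assms by (intro sets_PiM_I_finite) auto

lemma AE_nn_points_cube:
  assumes "1 \<le> n"
  shows "AE x in (nn_points n :: (nat \<Rightarrow> real ^ 'd::finite) measure). \<forall>i<n. x i \<in> torus_cube n"
proof -
  have "AE x in (nn_points n :: (nat \<Rightarrow> real ^ 'd) measure). x i \<in> torus_cube n" if "i < n" for i
    unfolding nn_points_def using that prob_space_torus_law[OF assms] AE_torus_law_cube[OF assms]
    by (intro AE_PiM_component) auto
  then have "AE x in (nn_points n :: (nat \<Rightarrow> real ^ 'd) measure). \<forall>i\<in>{..<n}. x i \<in> torus_cube n"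
    by (intro AE_finite_allI) auto
  then show ?thesis by (simp add: Ball_def)
qed

text \<open>For \<open>i\<close> outside \<open>{..<n}\<close> the coordinate is the constant
  \<open>undefined\<close> on the product space, so measurability holds for every index without a
  side condition.\<close>

lemma point_measurable [measurable]:
  "(\<lambda>x. x i) \<in> borel_measurable (nn_points n :: (nat \<Rightarrow> real ^ 'd::finite) measure)"
proof (cases "i < n")
  case True
  then have "(\<lambda>x. x i) \<in> measurable (nn_points n) (torus_law n :: (real ^ 'd) measure)"
    unfolding nn_points_def by (intro measurable_component_singleton) auto
  then show ?thesis by (simp add: measurable_cong_sets[OF refl sets_torus_law])
next
  case False
  then have "x i = undefined" if "x \<in> space (nn_points n :: (nat \<Rightarrow> real ^ 'd) measure)" for x
    using that by (auto simp: nn_points_def space_PiM PiE_def extensional_def)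
  then show ?thesis by (subst measurable_cong[where g = "\<lambda>_. undefined"]) auto
qed

lemma prod_at_point_and_below:
  assumes "j < n"
  shows "(\<Prod>k<n. if k = j then p else if k < j then q else (1::real)) = p * q ^ j"
proof -
  have "(\<Prod>k<n. if k = j then p else if k < j then q else 1) =
      (\<Prod>k\<in>insert j {..<j}. if k = j then p else if k < j then q else 1)"
    using assms by (intro prod.mono_neutral_right) auto
  also have "\<dots> = p * (\<Prod>k<j. q)" by (subst prod.insert) (auto intro!: prod.cong)
  finally show ?thesis by simp
qed

text \<open>The exceptional event for \<open>j\<close>: no older point shares its cell, so the grid
  gives no bound on the edge from \<open>j\<close> to its parent.\<close>

definition cell_isolated :: "nat \<Rightarrow> nat \<Rightarrow> nat \<Rightarrow> (nat \<Rightarrow> real ^ 'd::finite) set" where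
  "cell_isolated n m j = {x \<in> space (nn_points n). \<forall>k<j. grid_cell n m (x k) \<noteq> grid_cell n m (x j)}"

lemma cell_isolated_measurable [measurable]:
  "cell_isolated n m j \<in> sets (nn_points n :: (nat \<Rightarrow> real ^ 'd::finite) measure)"
  unfolding cell_isolated_def fun_eq_iff by measurable

text \<open>Split according to the cell of point \<open>j\<close>. Each of the m ^ d cells has
  probability p = m ^ (- d); that \<open>j\<close> falls in a given cell and the \<open>j\<close>
  older points avoid it has probability p * (1 - p) ^ j. Summing over the cells removes the factor
  p.\<close>

lemma prob_cell_isolated_le:
  assumes "j < n" "1 \<le> m"
  shows "measure (nn_points n) (cell_isolated n m j :: (nat \<Rightarrow> real ^ 'd::finite) set)
    \<le> (1 - (1 / m) ^ CARD('d)) ^ j"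
proof -
  have n: "1 \<le> n" using assms by simp
  interpret P: prob_space "nn_points n :: (nat \<Rightarrow> real ^ 'd) measure" by (rule prob_space_nn_points[OF n])
  interpret T: prob_space "torus_law n :: (real ^ 'd) measure" by (rule prob_space_torus_law[OF n])
  let ?A = "(UNIV :: 'd set) \<rightarrow>\<^sub>E {0..<int m}"
  let ?C = "\<lambda>a. {z :: real ^ 'd. grid_cell n m z = a}"
  let ?X = "\<lambda>a k. if k = j then ?C a else if k < j then - ?C a else UNIV"
  let ?p = "(1 / real m) ^ CARD('d)"
  have C: "?C a \<in> sets borel" for a by (rule grid_cell_sets)
  have X: "?X a k \<in> sets borel" for a k using C[of a] by auto
  have pr: "measure (nn_points n) (Pi\<^sub>E {..<n} (?X a)) = ?p * (1 - ?p) ^ j" if "a \<in> ?A" for a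
  proof -
    have p: "measure (torus_law n) (?C a) = ?p"
      using that by (intro measure_grid_cell[OF n assms(2)]) auto
    have "measure (torus_law n) (- ?C a) = 1 - ?p"
      using T.prob_compl[of "?C a"] C[of a] p by (simp add: Compl_eq_Diff_UNIV)
    then have "measure (torus_law n) (?X a k) = (if k = j then ?p else if k < j then 1 - ?p else 1)" for k
      using p T.prob_space by simp
    then show ?thesis
      using X by (simp add: measure_nn_points_PiE[OF n] prod_at_point_and_below[OF assms(1)] del: if_image_distrib)
  qed
  have "measure (nn_points n) (cell_isolated n m j :: (nat \<Rightarrow> real ^ 'd) set)
      \<le> measure (nn_points n) (\<Union>a\<in>?A. Pi\<^sub>E {..<n} (?X a))"
  proof (rule P.finite_measure_mono_AE)
    \<comment> \<open>The restriction to the cube ensures that the cell index of \<open>x j\<close>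
      is one of the m ^ d indices in \<open>?A\<close>.\<close>
    show "AE x in nn_points n. x \<in> cell_isolated n m j \<longrightarrow> x \<in> (\<Union>a\<in>?A. Pi\<^sub>E {..<n} (?X a))"
      using AE_nn_points_cube[OF n]
    proof (rule AE_mp, intro AE_I2 impI)
      fix x :: "nat \<Rightarrow> real ^ 'd"
      assume x: "\<forall>i<n. x i \<in> torus_cube n" "x \<in> cell_isolated n m j"
      have "grid_cell n m (x j) \<in> ?A"
        using grid_cell_bounds[OF n assms(2), of "x j"] x(1) assms(1) by auto
      moreover have "x \<in> Pi\<^sub>E {..<n} (?X (grid_cell n m (x j)))"
        using x(2) by (auto simp: cell_isolated_def nn_points_def space_PiM PiE_def Pi_def)
      ultimately show "x \<in> (\<Union>a\<in>?A. Pi\<^sub>E {..<n} (?X a))" by blast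
    qed
    show "(\<Union>a\<in>?A. Pi\<^sub>E {..<n} (?X a)) \<in> sets (nn_points n)"
      by (intro sets.finite_UN finite_PiE sets_nn_points_PiE X) auto
  qed
  also have "\<dots> \<le> (\<Sum>a\<in>?A. measure (nn_points n) (Pi\<^sub>E {..<n} (?X a)))"
    by (intro P.finite_measure_subadditive_finite finite_PiE image_subsetI sets_nn_points_PiE X) auto
  also have "\<dots> = real (card ?A) * (?p * (1 - ?p) ^ j)" using pr by simp
  also have "\<dots> = (1 - ?p) ^ j"
    using assms(2) by (simp add: card_PiE power_one_over)
  finally show ?thesis .
qed

lemma edge_length_le_grid:
  fixes x :: "nat \<Rightarrow> real ^ 'd::finite"
  assumes "1 \<le> n" "1 \<le> m" "x \<in> space (nn_points n)" "x \<notin> cell_isolated n m j"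
  shows "edge_length n x j \<le> real CARD('d) * torus_side TYPE('d) n / m"
proof -
  obtain k where k: "k < j" "grid_cell n m (x k) = grid_cell n m (x j)"
    using assms(3,4) by (auto simp: cell_isolated_def)
  have "edge_length n x j \<le> torus_dist n (x j) (x k)"
    unfolding edge_length_def by (rule nn_parent_min[OF k(1)])
  also have "\<dots> \<le> dist (x j) (x k)" by (rule torus_dist_le_dist)
  also have "\<dots> \<le> real CARD('d) * torus_side TYPE('d) n / m"
    by (intro dist_le_same_grid_cell assms) (use k in simp)
  finally show ?thesis .
qed

lemma edge_length_le_side:
  fixes x :: "nat \<Rightarrow> real ^ 'd::finite"
  assumes "\<forall>i<n. x i \<in> torus_cube n" "1 \<le> j" "j < n"
  shows "edge_length n x j \<le> real CARD('d) * torus_side TYPE('d) n"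
proof -
  have "nn_parent n x j < n" using nn_parent_less[OF assms(2), of n x] assms(3) by simp
  then show ?thesis
    unfolding edge_length_def
    using assms by (intro order_trans[OF torus_dist_le_dist] dist_le_torus_cube) auto
qed

section \<open>The probability of a short torus distance\<close>

lemma torus_dist_less_slab_neighbors:
  fixes y z :: "real ^ 'd::finite"
  assumes n: "1 \<le> n" and m: "1 \<le> m" and z: "z \<in> torus_cube n"
    and less: "torus_dist n y z < torus_side TYPE('d) n / m"
  shows "grid_cell n m z i \<in> (\<lambda>e. (grid_cell n m y i + e) mod int m) ` {-1, 0, 1}"
proof -
  let ?L = "torus_side TYPE('d) n"
  have L: "0 < ?L" by (rule torus_side_pos[OF n])
  \<comment> \<open>Some lattice translate of \<open>z\<close> is closer to \<open>y\<close> than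
    the mesh. In units of the mesh its coordinate \<open>i\<close> differs from that of
    \<open>y\<close> by less than 1, so the two integer parts differ by at most 1; the translation
    shifts the index by a multiple of \<open>m\<close>, hence the residue in the claim.\<close>
  obtain k where k: "dist y (z + lattice_shift n k) < ?L / m"
    using less unfolding torus_dist_def
    by (subst (asm) cINF_less_iff) (auto intro: bdd_below_torus_dist)
  have "\<bar>y $ i - z $ i - ?L * of_int (k $ i)\<bar> < ?L / m"
    using component_le_norm_cart[of "y - (z + lattice_shift n k)" i] k
    by (simp add: dist_norm diff_diff_eq)
  then have "\<bar>y $ i - z $ i - ?L * of_int (k $ i)\<bar> * (m / ?L) < ?L / m * (m / ?L)"
    using L m by (intro mult_strict_right_mono) auto
  also have "\<dots> = 1" using L m by simp
  also have "\<bar>y $ i - z $ i - ?L * of_int (k $ i)\<bar> * (m / ?L) =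
      \<bar>(y $ i - z $ i - ?L * of_int (k $ i)) * (m / ?L)\<bar>"
    using L by (simp add: abs_mult)
  also have "(y $ i - z $ i - ?L * of_int (k $ i)) * (m / ?L) =
      y $ i * m / ?L - z $ i * m / ?L - of_int (k $ i * int m)"
    using L by (simp add: field_simps)
  finally have lt: "\<bar>y $ i * m / ?L - z $ i * m / ?L - of_int (k $ i * int m)\<bar> < 1" .
  define e where "e = grid_cell n m z i - grid_cell n m y i + k $ i * int m"
  have "\<bar>e\<bar> \<le> 1"
    using lt unfolding e_def grid_cell_def by linarith
  then have e: "e \<in> {-1, 0, 1}" by auto
  have "grid_cell n m z i \<in> {0..<int m}" by (rule grid_cell_bounds[OF n m z])
  then have "grid_cell n m z i = grid_cell n m z i mod int m" by simp
  also have "\<dots> = (grid_cell n m y i + e) mod int m"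
    by (simp add: e_def)
  finally show ?thesis using e by blast
qed

lemma prod_at_two_points:
  fixes u v n :: nat
  assumes "u < n" "v < n" "u \<noteq> v"
  shows "(\<Prod>k<n. if k = u then p else if k = v then q else (1::real)) = p * q"
proof -
  have "(\<Prod>k<n. if k = u then p else if k = v then q else 1) =
      (\<Prod>k\<in>{u, v}. if k = u then p else if k = v then q else 1)"
    using assms by (intro prod.mono_neutral_right) auto
  then show ?thesis using assms by simp
qed

text \<open>If the two points are that close, their slabs in a fixed coordinate are equal or
  cyclically adjacent. There are at most 3 * m such pairs of slabs, each with probability 1 / m ^ 2
  by independence.\<close>

lemma prob_torus_dist_less_le:
  fixes n m u v :: nat
  assumes n: "1 \<le> n" and m: "1 \<le> m" and uv: "u < n" "v < n" "u \<noteq> v"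
  shows "measure (nn_points n) {x \<in> space (nn_points n :: (nat \<Rightarrow> real ^ 'd::finite) measure).
    torus_dist n (x u) (x v) < torus_side TYPE('d) n / m} \<le> 3 / m"
proof -
  interpret P: prob_space "nn_points n :: (nat \<Rightarrow> real ^ 'd) measure" by (rule prob_space_nn_points[OF n])
  interpret T: prob_space "torus_law n :: (real ^ 'd) measure" by (rule prob_space_torus_law[OF n])
  \<comment> \<open>Any fixed coordinate serves here.\<close>
  define i0 :: 'd where "i0 = undefined"
  let ?N = "\<lambda>a. (\<lambda>e. (a + e) mod int m) ` {-1, 0, 1}"
  let ?A = "Sigma {0..<int m} ?N"
  let ?S = "slab n m i0 :: int \<Rightarrow> (real ^ 'd) set"
  let ?X = "\<lambda>(a, b) k. if k = u then ?S a else if k = v then ?S b else UNIV"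
  have X: "?X ab k \<in> sets borel" for ab k by (cases ab) auto
  have pr: "measure (nn_points n) (Pi\<^sub>E {..<n} (?X ab)) = 1 / m * (1 / m)" if "ab \<in> ?A" for ab
  proof -
    obtain a b where ab: "ab = (a, b)" by (cases ab)
    have ab: "ab = (a, b)" "a \<in> {0..<int m}" "b \<in> ?N a"
      using that unfolding ab mem_Sigma_iff by blast+
    have b: "b \<in> {0..<int m}" using ab(3) m by auto
    have "measure (torus_law n) (?X ab k) = (if k = u then 1 / m else if k = v then 1 / m else 1)" for k
      using measure_slab[OF n m ab(2), of i0] measure_slab[OF n m b, of i0] T.prob_space by (simp add: ab(1))
    then show ?thesis
      using X by (simp only: measure_nn_points_PiE[OF n] prod_at_two_points[OF uv])
  qed
  \<comment> \<open>Only an inequality, since for \<open>m\<close> at most 2 some of the three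
    residues coincide.\<close>
  have cA: "card ?A \<le> m * 3"
  proof -
    have "card ?A = (\<Sum>a\<in>{0..<int m}. card (?N a))" by (rule card_SigmaI) auto
    also have "\<dots> \<le> (\<Sum>a\<in>{0..<int m}. 3)"
      by (intro sum_mono order_trans[OF card_image_le]) auto
    finally show ?thesis by simp
  qed
  have "P.prob {x \<in> space (nn_points n). torus_dist n (x u) (x v) < torus_side TYPE('d) n / m}
      \<le> P.prob (\<Union>ab\<in>?A. Pi\<^sub>E {..<n} (?X ab))"
  proof (rule P.finite_measure_mono_AE)
    show "AE x in nn_points n.
        x \<in> {x \<in> space (nn_points n). torus_dist n (x u) (x v) < torus_side TYPE('d) n / m} \<longrightarrow>
        x \<in> (\<Union>ab\<in>?A. Pi\<^sub>E {..<n} (?X ab))"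
      using AE_nn_points_cube[OF n]
    proof (rule AE_mp, intro AE_I2 impI)
      fix x :: "nat \<Rightarrow> real ^ 'd"
      assume x: "\<forall>i<n. x i \<in> torus_cube n"
        "x \<in> {x \<in> space (nn_points n). torus_dist n (x u) (x v) < torus_side TYPE('d) n / m}"
      let ?ab = "(grid_cell n m (x u) i0, grid_cell n m (x v) i0)"
      have "?ab \<in> ?A"
        using grid_cell_bounds[OF n m, of "x u" i0] x uv
          torus_dist_less_slab_neighbors[OF n m, of "x v" "x u" i0] by auto
      moreover have "x \<in> Pi\<^sub>E {..<n} (?X ?ab)"
        using x uv by (auto simp: slab_def nn_points_def space_PiM PiE_def Pi_def)
      ultimately show "x \<in> (\<Union>ab\<in>?A. Pi\<^sub>E {..<n} (?X ab))" by blast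
    qed
    show "(\<Union>ab\<in>?A. Pi\<^sub>E {..<n} (?X ab)) \<in> sets (nn_points n)"
      by (intro sets.finite_UN sets_nn_points_PiE X) auto
  qed
  also have "\<dots> \<le> (\<Sum>ab\<in>?A. P.prob (Pi\<^sub>E {..<n} (?X ab)))"
    by (intro P.finite_measure_subadditive_finite image_subsetI sets_nn_points_PiE X) auto
  also have "\<dots> = real (card ?A) * (1 / m * (1 / m))" using pr by simp
  also have "\<dots> \<le> real (m * 3) * (1 / m * (1 / m))"
    using cA by (intro mult_right_mono of_nat_mono) auto
  also have "\<dots> = 3 / m" using m by simp
  finally show ?thesis .
qed

section \<open>Exchangeability of the ancestors\<close>

lemma pred_le_real [measurable (raw)]:
  fixes f g :: "'a \<Rightarrow> real"
  assumes [measurable]: "f \<in> borel_measurable M" "g \<in> borel_measurable M"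
  shows "Measurable.pred M (\<lambda>x. f x \<le> g x)"
  by measurable

lemma pred_eq_real [measurable (raw)]:
  fixes f g :: "'a \<Rightarrow> real"
  assumes [measurable]: "f \<in> borel_measurable M" "g \<in> borel_measurable M"
  shows "Measurable.pred M (\<lambda>x. f x = g x)"
  by measurable

text \<open>Breaking ties by age depends on the labels and is not preserved by relabelling. Without
  ties the parent is determined by the positions of the older points alone. All triples are
  included, whatever the order of their labels, so that the condition itself survives
  relabelling.\<close>

definition no_ties :: "nat \<Rightarrow> (nat \<Rightarrow> real ^ 'd::finite) \<Rightarrow> bool" where
  "no_ties n x \<longleftrightarrow> (\<forall>a<n. \<forall>b<n. \<forall>k<n. a \<noteq> b \<longrightarrow> a \<noteq> k \<longrightarrow> b \<noteq> k \<longrightarrow>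
    torus_dist n (x a) (x b) \<noteq> torus_dist n (x a) (x k))"

text \<open>For a given triple, fix all points except \<open>k\<close>. A tie then forces point
  \<open>k\<close> to lie at a prescribed distance from point \<open>a\<close>, which has
  probability 0; Fubini concludes.\<close>

lemma AE_no_ties:
  assumes n: "1 \<le> n"
  shows "AE x in (nn_points n :: (nat \<Rightarrow> real ^ 'd::finite) measure). no_ties n x"
proof -
  let ?M = "nn_points n :: (nat \<Rightarrow> real ^ 'd) measure"
  interpret T: prob_space "torus_law n :: (real ^ 'd) measure" by (rule prob_space_torus_law[OF n])
  interpret product_sigma_finite "\<lambda>_::nat. torus_law n :: (real ^ 'd) measure"
    by unfold_locales
  have one: "AE x in ?M. torus_dist n (x a) (x b) \<noteq> torus_dist n (x a) (x k)"
    if abk: "a < n" "b < n" "k < n" "a \<noteq> b" "a \<noteq> k" "b \<noteq> k" for a b k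
  proof -
    let ?I = "{..<n} - {k}"
    \<comment> \<open>The null set for point \<open>k\<close> is available only when
      \<open>x a\<close> lies in the cube; this holds almost surely and is discharged at the
      end.\<close>
    let ?Q = "\<lambda>x. x a \<in> torus_cube n \<and> torus_dist n (x a) (x b) = torus_dist n (x a) (x k)"
    have ins: "insert k ?I = {..<n}" using abk by auto
    let ?A = "{x \<in> space ?M. ?Q x}"
    have A: "?A \<in> sets ?M" by measurable
    then have f: "(indicator ?A :: _ \<Rightarrow> ennreal) \<in> borel_measurable (\<Pi>\<^sub>M i\<in>insert k ?I. torus_law n)"
      unfolding ins nn_points_def by (rule borel_measurable_indicator)
    have "emeasure ?M ?A = (\<integral>\<^sup>+x. indicator ?A x \<partial>(\<Pi>\<^sub>M i\<in>insert k ?I. torus_law n))"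
      using A unfolding ins nn_points_def by (rule nn_integral_indicator[symmetric])
    also have "\<dots> = (\<integral>\<^sup>+x. (\<integral>\<^sup>+y. indicator ?A (x(k := y)) \<partial>torus_law n)
        \<partial>(\<Pi>\<^sub>M i\<in>?I. torus_law n))"
      by (rule product_nn_integral_insert[OF _ _ f]) simp_all
    also have "\<dots> = (\<integral>\<^sup>+x. 0 \<partial>(\<Pi>\<^sub>M i\<in>?I. torus_law n :: (real ^ 'd) measure))"
    proof (intro nn_integral_cong)
      fix x :: "nat \<Rightarrow> real ^ 'd"
      have "AE y in torus_law n. indicator ?A (x(k := y)) = (0 :: ennreal)"
      proof (cases "x a \<in> torus_cube n")
        case True
        show ?thesis
          using AE_torus_law_neq_torus_dist[OF n True, of "torus_dist n (x a) (x b)"]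
          by eventually_elim (use abk in \<open>auto simp: indicator_def\<close>)
      qed (use abk in \<open>auto simp: indicator_def\<close>)
      then show "(\<integral>\<^sup>+y. indicator ?A (x(k := y)) \<partial>torus_law n) = 0"
        by (simp add: nn_integral_cong_AE[where v = "\<lambda>_. 0"])
    qed
    finally have "AE x in ?M. \<not> ?Q x"
      using A by (intro AE_I[where N = ?A]) auto
    with AE_nn_points_cube[OF n] show ?thesis
      by eventually_elim (use abk in auto)
  qed
  have "AE x in ?M. \<forall>a\<in>{..<n}. \<forall>b\<in>{..<n}. \<forall>k\<in>{..<n}. a \<noteq> b \<longrightarrow> a \<noteq> k \<longrightarrow> b \<noteq> k \<longrightarrow>
      torus_dist n (x a) (x b) \<noteq> torus_dist n (x a) (x k)"
    using one by (intro AE_finite_allI finite_lessThan) auto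
  then show ?thesis
    by eventually_elim (auto simp: no_ties_def)
qed

lemma nn_parent_unique:
  assumes "no_ties n x" "i < n" "b < i"
    "\<And>k. k < i \<Longrightarrow> torus_dist n (x i) (x b) \<le> torus_dist n (x i) (x k)"
  shows "nn_parent n x i = b"
proof (rule ccontr)
  let ?c = "nn_parent n x i"
  assume "?c \<noteq> b"
  have c: "?c < i" using assms(3) by (intro nn_parent_less) auto
  have "torus_dist n (x i) (x b) = torus_dist n (x i) (x ?c)"
    using assms(4)[OF c] nn_parent_min[OF assms(3), of n x] by simp
  then show False
    using assms c \<open>?c \<noteq> b\<close> unfolding no_ties_def by (metis less_trans nat_neq_iff)
qed

lemma no_ties_reindex:
  assumes "no_ties n x" "bij_betw \<tau> {..<n} {..<n}" "\<And>k. k < n \<Longrightarrow> y k = x (\<tau> k)"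
  shows "no_ties n y"
  unfolding no_ties_def
proof (intro allI impI)
  fix a b k assume *: "a < n" "b < n" "k < n" "a \<noteq> b" "a \<noteq> k" "b \<noteq> k"
  have "\<tau> a < n" "\<tau> b < n" "\<tau> k < n" "\<tau> a \<noteq> \<tau> b" "\<tau> a \<noteq> \<tau> k" "\<tau> b \<noteq> \<tau> k"
    using * assms(2) by (auto simp: bij_betw_def inj_on_def)
  then show "torus_dist n (y a) (y b) \<noteq> torus_dist n (y a) (y k)"
    using * assms(1,3) unfolding no_ties_def by simp
qed

text \<open>Above \<open>j\<close> the chain depends on the points \<open>0, \<dots>, j\<close> only as a set, so relabelling them relabels
  the entry point.\<close>

lemma entry_nn_parent_transpose:
  fixes x y :: "nat \<Rightarrow> real ^ 'd::finite" and i j :: nat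
  defines "\<tau> \<equiv> Transposition.transpose i j"
  assumes x: "no_ties n x" and ij: "i \<le> j" and y: "\<And>k. k < n \<Longrightarrow> y k = x (\<tau> k)"
    and u: "j < u" "u < n"
  shows "entry (nn_parent n y) j u = \<tau> (entry (nn_parent n x) j u)"
proof -
  \<comment> \<open>Both \<open>i\<close> and \<open>j\<close> are at most \<open>j\<close>, so for
    \<open>a\<close> above \<open>j\<close> the transposition fixes \<open>a\<close> and permutes
    the labels older than \<open>a\<close>.\<close>
  have above: "\<tau> a = a" if "j < a" for a
    using that ij by (simp add: \<tau>_def Transposition.transpose_def)
  have lt: "\<tau> b < a" if "j < a" "b < a" for a b
    using that ij by (simp add: \<tau>_def Transposition.transpose_def)
  have inv: "\<tau> (\<tau> b) = b" for b by (simp add: \<tau>_def)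
  have yt: "no_ties n y"
  proof (rule no_ties_reindex[OF x _ y])
    show "bij_betw \<tau> {..<n} {..<n}"
      by (rule bij_betw_byWitness[where f' = \<tau>]) (use inv lt u in \<open>auto intro: lt\<close>)
  qed
  \<comment> \<open>Both parents minimise the distance from the same point over the same set of
    older points; without ties the minimiser is unique, so the two differ only by the relabelling
    \<tau>.\<close>
  have par: "nn_parent n y a = \<tau> (nn_parent n x a)" if a: "j < a" "a < n" for a
  proof (rule nn_parent_unique[OF yt a(2)])
    have p: "nn_parent n x a < a" using a by (intro nn_parent_less) auto
    then show p': "\<tau> (nn_parent n x a) < a" by (rule lt[OF a(1)])
    fix k assume k: "k < a"
    have "torus_dist n (x a) (x (nn_parent n x a)) \<le> torus_dist n (x a) (x (\<tau> k))"
      by (rule nn_parent_min[OF lt[OF a(1) k]])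
    then show "torus_dist n (y a) (y (\<tau> (nn_parent n x a))) \<le> torus_dist n (y a) (y k)"
      using a k p' by (simp add: y above inv)
  qed
  show ?thesis using u
  proof (induction u rule: less_induct)
    case (less u)
    let ?p = "nn_parent n x u"
    have p: "?p < u" "nn_parent n y u < u" using less.prems by (auto intro: nn_parent_less)
    show ?case
    \<comment> \<open>Either the chain stops at the parent, which \<tau> relabels within the labels
      up to \<open>j\<close>, or the parent lies above \<open>j\<close>, is fixed by \<tau>, and the
      induction hypothesis applies to it.\<close>
    proof (cases "?p \<le> j")
      case True
      then have "\<tau> ?p \<le> j" using ij by (auto simp: \<tau>_def Transposition.transpose_def)
      then show ?thesis using True less.prems p by (simp add: entry_step par entry_self)
    next
      case False
      then show ?thesis using less.prems p less.IH[of ?p] by (simp add: entry_step par above)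
    qed
  qed
qed

section \<open>Measurability of the tree and of the stretch factor\<close>

lemma nn_parent_measurable [measurable]:
  "(\<lambda>x. nn_parent n x i) \<in> measurable (nn_points n :: (nat \<Rightarrow> real ^ 'd::finite) measure) (count_space UNIV)"
  unfolding nn_parent_def by measurable

text \<open>The path depends on the positions only through the finite list of parents. Such lists
  form a countable set, out of which every function is measurable, so the definite description need
  not be analysed.\<close>

lemma nn_path_measurable [measurable]:
  "(\<lambda>x. nn_path n x u v) \<in> measurable (nn_points n :: (nat \<Rightarrow> real ^ 'd::finite) measure) (count_space UNIV)"
proof -
  let ?M = "nn_points n :: (nat \<Rightarrow> real ^ 'd) measure"
  define parents where "parents x = map (nn_parent n x) [0..<n]" for x :: "nat \<Rightarrow> real ^ 'd"
  define edges where "edges l = {{i, l ! i} | i. 1 \<le> i \<and> i < n}" for l :: "nat list"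
  have "nn_edges n x = edges (parents x)" for x :: "nat \<Rightarrow> real ^ 'd"
    by (auto simp: nn_edges_def edges_def parents_def)
  then have path: "nn_path n x u v = (THE q. is_path (edges (parents x)) u v q)" for x :: "nat \<Rightarrow> real ^ 'd"
    by (simp add: nn_path_def)
  have "parents \<in> measurable ?M (count_space UNIV)"
    unfolding measurable_count_space_eq2_countable
  proof (intro conjI ballI)
    fix l :: "nat list"
    have "parents x = l \<longleftrightarrow> length l = n \<and> (\<forall>i<n. nn_parent n x i = l ! i)" for x
      unfolding list_eq_iff_nth_eq[of "parents x" l] by (auto simp: parents_def)
    then have "parents -` {l} \<inter> space ?M = {x \<in> space ?M. length l = n \<and> (\<forall>i<n. nn_parent n x i = l ! i)}"
      by blast
    also have "\<dots> \<in> sets ?M" by measurable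
    finally show "parents -` {l} \<inter> space ?M \<in> sets ?M" .
  qed simp
  then show ?thesis unfolding path by (rule measurable_compose) simp
qed

lemma stretch_factor_measurable [measurable]:
  "(\<lambda>x. stretch_factor n x u v) \<in> borel_measurable (nn_points n :: (nat \<Rightarrow> real ^ 'd::finite) measure)"
proof -
  have "(\<lambda>x. path_length n x q) \<in> borel_measurable (nn_points n :: (nat \<Rightarrow> real ^ 'd) measure)" for q
    unfolding path_length_def by measurable
  then have [measurable]: "(\<lambda>x. path_length n x (nn_path n x u v)) \<in>
      borel_measurable (nn_points n :: (nat \<Rightarrow> real ^ 'd) measure)"
    by (rule measurable_compose_countable) measurable
  show ?thesis unfolding stretch_factor_def by measurable
qed

lemma entry_measurable [measurable]:
  "(\<lambda>x. entry (nn_parent n x) j u) \<in>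
    measurable (nn_points n :: (nat \<Rightarrow> real ^ 'd::finite) measure) (count_space UNIV)"
proof (induction u rule: less_induct)
  case (less u)
  let ?M = "nn_points n :: (nat \<Rightarrow> real ^ 'd) measure"
  show ?case
  proof (cases "u \<le> j")
    case True
    then show ?thesis by (simp add: entry_self)
  next
    case False
    \<comment> \<open>The guard restricts to labels covered by the induction hypothesis; the parent
      of \<open>u\<close>, a countable-valued random index, always satisfies it.\<close>
    let ?f = "\<lambda>i x. if i < u then entry (nn_parent n x) j i else 0"
    have "?f i \<in> measurable ?M (count_space UNIV)" for i
      using less by (cases "i < u") auto
    then have "(\<lambda>x. ?f (nn_parent n x u) x) \<in> measurable ?M (count_space UNIV)"
      by (rule measurable_compose_countable) measurable
    moreover have "nn_parent n x u < u" for x :: "nat \<Rightarrow> real ^ 'd"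
      using False by (intro nn_parent_less) auto
    then have "entry (nn_parent n x) j u = ?f (nn_parent n x u) x" for x :: "nat \<Rightarrow> real ^ 'd"
      using False by (simp add: entry_step)
    ultimately show ?thesis by simp
  qed
qed

section \<open>The probability of being an ancestor\<close>

definition ancestor_event :: "nat \<Rightarrow> nat \<Rightarrow> nat \<Rightarrow> nat \<Rightarrow> (nat \<Rightarrow> real ^ 'd::finite) set" where
  "ancestor_event n u j i = {x \<in> space (nn_points n). entry (nn_parent n x) j u = i}"

lemma ancestor_event_sets [measurable]:
  "ancestor_event n u j i \<in> sets (nn_points n :: (nat \<Rightarrow> real ^ 'd::finite) measure)"
  unfolding ancestor_event_def by measurable

text \<open>Swapping the positions of \<open>i\<close> and \<open>j\<close> preserves the product
  law and, outside ties, turns the event of entering the labels up to \<open>j\<close> at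
  \<open>j\<close> into that of entering at \<open>i\<close>.\<close>

lemma prob_ancestor_event_eq:
  assumes "j < u" "u < n" "i \<le> j"
  shows "measure (nn_points n) (ancestor_event n u j i :: (nat \<Rightarrow> real ^ 'd::finite) set) =
    measure (nn_points n) (ancestor_event n u j j :: (nat \<Rightarrow> real ^ 'd) set)"
proof -
  let ?M = "nn_points n :: (nat \<Rightarrow> real ^ 'd) measure"
  let ?\<tau> = "Transposition.transpose i j"
  \<comment> \<open>The restriction keeps the permuted configuration in the product space, whose
    elements are \<open>undefined\<close> outside \<open>{..<n}\<close>.\<close>
  let ?T = "\<lambda>x :: nat \<Rightarrow> real ^ 'd. \<lambda>k\<in>{..<n}. x (?\<tau> k)"
  have n: "1 \<le> n" using assms by simp
  interpret P: prob_space ?M by (rule prob_space_nn_points[OF n])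
  have im: "?\<tau> \<in> {..<n} \<rightarrow> {..<n}"
    using assms by (auto simp: Transposition.transpose_def)
  have distr: "distr ?M ?M ?T = ?M"
    unfolding nn_points_def using prob_space_torus_law[OF n] im
    by (intro distr_PiM_reindex) (auto intro: inj_on_subset[OF inj_transpose])
  have T: "?T \<in> measurable ?M ?M"
    unfolding nn_points_def using im by (intro measurable_restrict measurable_component_singleton) auto
  have "measure ?M (ancestor_event n u j j) = measure (distr ?M ?M ?T) (ancestor_event n u j j)"
    unfolding distr ..
  also have "\<dots> = measure ?M (?T -` ancestor_event n u j j \<inter> space ?M)"
    by (rule measure_distr[OF T ancestor_event_sets])
  also have "\<dots> = measure ?M (ancestor_event n u j i)"
  proof (rule P.finite_measure_eq_AE)
    show "AE x in ?M. x \<in> ?T -` ancestor_event n u j j \<inter> space ?M \<longleftrightarrow> x \<in> ancestor_event n u j i"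
      using AE_no_ties[OF n]
    proof (rule AE_mp, intro AE_I2 impI)
      fix x :: "nat \<Rightarrow> real ^ 'd"
      assume x: "x \<in> space ?M" "no_ties n x"
      have "entry (nn_parent n (?T x)) j u = ?\<tau> (entry (nn_parent n x) j u)"
        by (rule entry_nn_parent_transpose[OF x(2) assms(3) _ assms(1,2)]) simp
      moreover have "?\<tau> k = j \<longleftrightarrow> k = i" for k
        by (auto simp: Transposition.transpose_def)
      ultimately show "x \<in> ?T -` ancestor_event n u j j \<inter> space ?M \<longleftrightarrow> x \<in> ancestor_event n u j i"
        using x(1) measurable_space[OF T x(1)] by (simp add: ancestor_event_def)
    qed
    show "?T -` ancestor_event n u j j \<inter> space ?M \<in> sets ?M"
      by (rule measurable_sets[OF T ancestor_event_sets])
  qed (rule ancestor_event_sets)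
  finally show ?thesis by simp
qed

text \<open>The \<open>j + 1\<close> possible entry points give disjoint events of equal
  probability.\<close>

lemma prob_ancestor_event_le:
  assumes "j < u" "u < n"
  shows "measure (nn_points n) (ancestor_event n u j j :: (nat \<Rightarrow> real ^ 'd::finite) set) \<le> 1 / (real j + 1)"
proof -
  let ?M = "nn_points n :: (nat \<Rightarrow> real ^ 'd) measure"
  interpret P: prob_space ?M using assms by (intro prob_space_nn_points) simp
  have "(\<Sum>i\<in>{..j}. measure ?M (ancestor_event n u j i)) = measure ?M (\<Union>i\<in>{..j}. ancestor_event n u j i)"
    by (intro P.finite_measure_finite_Union[symmetric])
      (auto simp: disjoint_family_on_def ancestor_event_def[of _ _ _ _] intro: ancestor_event_sets)
  also have "\<dots> \<le> 1" by simp
  also have "(\<Sum>i\<in>{..j}. measure ?M (ancestor_event n u j i)) = (\<Sum>i\<in>{..j}. measure ?M (ancestor_event n u j j))"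
    using prob_ancestor_event_eq[OF assms] by (intro sum.cong) auto
  finally show ?thesis by (simp add: field_simps)
qed

text \<open>Any exponent strictly between \<open>0\<close> and \<open>1 / d\<close> would do: the cells must be small enough
  for \<open>\<Sum>\<^sub>j 1 / (j * grid_size d j)\<close> to converge, and large enough for one of \<open>j\<close> points
  to share a given cell with overwhelming probability.\<close>

definition grid_size :: "nat \<Rightarrow> nat \<Rightarrow> nat" where
  "grid_size d j = nat \<lfloor>real j powr (1 / (2 * real d))\<rfloor>"

text \<open>Bounds the expected contribution of the edge above \<open>j\<close>, in units of d times
  the side: the mesh 1 / m weighted by the probability of being an ancestor, plus the probability
  that \<open>j\<close> is isolated in its cell.\<close>

definition climb_weight :: "nat \<Rightarrow> nat \<Rightarrow> real" where
  "climb_weight d j = 1 / (real (grid_size d j) * (real j + 1)) + exp (- sqrt (real j))"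

lemma climb_weight_nonneg: "0 \<le> climb_weight d j"
  by (simp add: climb_weight_def)

lemma half_le_floor: "1 \<le> t \<Longrightarrow> t / 2 \<le> of_int \<lfloor>t :: real\<rfloor>"
proof -
  assume "1 \<le> t"
  then have "1 \<le> real_of_int \<lfloor>t\<rfloor>" by (simp add: le_floor_iff)
  moreover have "t < of_int \<lfloor>t\<rfloor> + 1" by linarith
  ultimately show ?thesis by linarith
qed

lemma grid_size_ge:
  assumes "1 \<le> j"
  shows "1 \<le> grid_size d j" "real j powr (1 / (2 * real d)) / 2 \<le> real (grid_size d j)"
proof -
  have t: "1 \<le> real j powr (1 / (2 * real d))" using assms by (intro ge_one_powr_ge_zero) auto
  then show "1 \<le> grid_size d j" unfolding grid_size_def by linarith
  show "real j powr (1 / (2 * real d)) / 2 \<le> real (grid_size d j)"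
    using half_le_floor[OF t] by (simp add: grid_size_def of_nat_nat)
qed

lemma grid_size_le: "real (grid_size d j) \<le> real j powr (1 / (2 * real d))"
  unfolding grid_size_def by (simp add: of_nat_nat)

text \<open>The choice of the grid makes the number m ^ d of cells at most \<open>sqrt j\<close>, so
  the expected number j / m ^ d of older points in a given cell is at least \<open>sqrt j\<close>;
  then 1 - y \<le> exp (- y) is applied.\<close>

lemma isolated_bound_le_exp:
  assumes "1 \<le> d" "1 \<le> j"
  shows "(1 - (1 / real (grid_size d j)) ^ d) ^ j \<le> exp (- sqrt (real j))"
proof -
  let ?m = "real (grid_size d j)"
  let ?y = "(1 / ?m) ^ d"
  have m: "1 \<le> ?m" using grid_size_ge(1)[OF assms(2), of d] by simp
  have "?m ^ d \<le> (real j powr (1 / (2 * real d))) ^ d"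
    using grid_size_le by (intro power_mono) auto
  also have "\<dots> = sqrt (real j)"
    using assms by (simp add: powr_powr powr_half_sqrt flip: powr_realpow')
  finally have "?m ^ d \<le> sqrt (real j)" .
  then have "1 / sqrt (real j) \<le> ?y"
    using m assms by (simp add: power_one_over frac_le)
  then have "real j * (1 / sqrt (real j)) \<le> real j * ?y"
    by (intro mult_left_mono) auto
  then have s: "sqrt (real j) \<le> real j * ?y"
    using assms by (simp add: real_div_sqrt)
  have "?y \<le> 1" using m by (simp add: power_le_one)
  then have "(1 - ?y) ^ j \<le> exp (- ?y) ^ j"
    using exp_ge_add_one_self[of "- ?y"] by (intro power_mono) auto
  also have "\<dots> = exp (- (real j * ?y))"
    by (simp flip: exp_of_nat_mult)
  also have "\<dots> \<le> exp (- sqrt (real j))" using s by simp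
  finally show ?thesis .
qed

text \<open>Rounding the grid size down costs at most a factor 2, so the first part is dominated by
  a power of \<open>j\<close> with exponent below -1; the second part decays faster than j ^ (-
  2).\<close>

lemma summable_climb_weight:
  assumes "1 \<le> d"
  shows "summable (climb_weight d)"
proof -
  have "summable (\<lambda>j. 1 / (real (grid_size d j) * (real j + 1)))"
  proof (rule summable_comparison_test')
    show "summable (\<lambda>j. 2 * real j powr (- (1 + 1 / (2 * real d))))"
      using assms by (intro summable_mult) (simp add: summable_real_powr_iff)
    fix j :: nat
    assume j: "1 \<le> j"
    let ?t = "real j powr (1 / (2 * real d))"
    have "1 / (real (grid_size d j) * (real j + 1)) \<le> 1 / (?t / 2 * real j)"
      using grid_size_ge[OF j, of d] j by (intro divide_left_mono mult_mono mult_pos_pos) auto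
    also have "\<dots> = 2 * real j powr (- (1 + 1 / (2 * real d)))"
    proof -
      have e: "real j powr (1 + 1 / (2 * real d)) = real j * ?t"
        using j by (simp only: powr_add powr_one)
      show ?thesis unfolding powr_minus_divide e by simp
    qed
    finally show "norm (1 / (real (grid_size d j) * (real j + 1))) \<le> 2 * real j powr (- (1 + 1 / (2 * real d)))"
      by simp
  qed
  moreover have "summable (\<lambda>j. exp (- sqrt (real j)))"
  proof (rule summable_comparison_test_bigo)
    show "summable (\<lambda>j. norm (1 / real j ^ 2))"
      using inverse_power_summable[of 2, where 'a = real] by (simp add: field_simps)
    show "(\<lambda>j. exp (- sqrt (real j))) \<in> O(\<lambda>j. 1 / real j ^ 2)"
      by real_asymp
  qed
  ultimately show ?thesis unfolding climb_weight_def[abs_def] by (rule summable_add)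
qed

text \<open>A random bound on the path to the root, in units of d times the side. The leading 1 pays
  for the edge above \<open>u\<close> itself; an ancestor \<open>j < u\<close> pays one mesh, or one
  full unit if it is isolated. Isolation is charged whether or not \<open>j\<close> is an ancestor,
  which avoids the joint law of the two events.\<close>

definition climb_bound :: "nat \<Rightarrow> nat \<Rightarrow> (nat \<Rightarrow> real ^ 'd::finite) \<Rightarrow> real" where
  "climb_bound n u x = 1 + (\<Sum>j = 1..<u. indicator (ancestor_event n u j j) x / grid_size CARD('d) j +
      indicator (cell_isolated n (grid_size CARD('d) j) j) x)"

lemma climb_bound_integrable:
  assumes "1 \<le> n"
  shows "integrable (nn_points n) (climb_bound n u :: (nat \<Rightarrow> real ^ 'd::finite) \<Rightarrow> real)"
proof -
  interpret P: prob_space "nn_points n :: (nat \<Rightarrow> real ^ 'd) measure" by (rule prob_space_nn_points[OF assms])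
  show ?thesis
    unfolding climb_bound_def[abs_def]
    by (intro Bochner_Integration.integrable_add Bochner_Integration.integrable_sum
        integrable_divide_zero integrable_real_indicator) (auto simp: P.emeasure_finite less_top[symmetric])
qed

lemma expectation_climb_bound_le:
  assumes "u < n"
  shows "(\<integral>x. climb_bound n u x \<partial>(nn_points n :: (nat \<Rightarrow> real ^ 'd::finite) measure))
    \<le> 1 + (\<Sum>j. climb_weight CARD('d) j)"
proof -
  have n: "1 \<le> n" using assms by simp
  let ?M = "nn_points n :: (nat \<Rightarrow> real ^ 'd) measure"
  interpret P: prob_space ?M by (rule prob_space_nn_points[OF n])
  let ?m = "grid_size CARD('d)"
  have i1: "integrable ?M (\<lambda>x. indicator (ancestor_event n u j j) x / ?m j :: real)" for j
    by (intro integrable_divide_zero integrable_real_indicator) (auto simp: P.emeasure_finite less_top[symmetric])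
  have i2: "integrable ?M (\<lambda>x. indicator (cell_isolated n (?m j) j) x :: real)" for j
    by (intro integrable_real_indicator) (auto simp: P.emeasure_finite less_top[symmetric])
  have "(\<integral>x. climb_bound n u x \<partial>?M) = 1 + (\<Sum>j = 1..<u. P.prob (ancestor_event n u j j) / ?m j +
      P.prob (cell_isolated n (?m j) j))"
    unfolding climb_bound_def using i1 i2
    by (simp add: P.prob_space)
  also have "(\<Sum>j = 1..<u. P.prob (ancestor_event n u j j) / ?m j + P.prob (cell_isolated n (?m j) j))
      \<le> (\<Sum>j = 1..<u. climb_weight CARD('d) j)"
  proof (rule sum_mono)
    fix j assume j: "j \<in> {1..<u}"
    have m: "1 \<le> ?m j" using j by (intro grid_size_ge) auto
    have "P.prob (ancestor_event n u j j) / ?m j \<le> 1 / (real j + 1) / ?m j"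
      using j assms by (intro divide_right_mono prob_ancestor_event_le) auto
    moreover have "P.prob (cell_isolated n (?m j) j) \<le> exp (- sqrt (real j))"
      using j assms by (intro order_trans[OF prob_cell_isolated_le[OF _ m] isolated_bound_le_exp]) auto
    ultimately show "P.prob (ancestor_event n u j j) / ?m j + P.prob (cell_isolated n (?m j) j)
        \<le> climb_weight CARD('d) j"
      by (simp add: climb_weight_def mult.commute)
  qed
  also have "\<dots> \<le> (\<Sum>j. climb_weight CARD('d) j)"
    by (intro sum_le_suminf summable_climb_weight) (auto simp: climb_weight_nonneg)
  finally show ?thesis by simp
qed

lemma climb_le_climb_bound:
  fixes x :: "nat \<Rightarrow> real ^ 'd::finite"
  assumes u: "u < n" and x: "x \<in> space (nn_points n)" "\<forall>i<n. x i \<in> torus_cube n"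
  shows "climb (edge_length n x) (nn_parent n x) u \<le>
    real CARD('d) * torus_side TYPE('d) n * climb_bound n u x"
proof -
  have n: "1 \<le> n" using u by simp
  let ?D = "real CARD('d) * torus_side TYPE('d) n"
  let ?m = "grid_size CARD('d)"
  let ?Y = "\<lambda>j. indicator (ancestor_event n u j j) x / ?m j + indicator (cell_isolated n (?m j) j) x :: real"
  have D: "0 \<le> ?D" using torus_side_pos[OF n, where ?'d = 'd] by simp
  have Y: "0 \<le> ?Y j" for j by (intro add_nonneg_nonneg divide_nonneg_nonneg) auto
  show ?thesis
  proof (cases "u = 0")
    case True
    then show ?thesis using D by (simp add: climb_def climb_bound_def)
  next
    case False
    let ?c = "\<lambda>j. if entry (nn_parent n x) j u = j then edge_length n x j else 0"
    have "climb (edge_length n x) (nn_parent n x) u = (\<Sum>j\<in>insert u {1..<u}. ?c j)"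
      unfolding climb_def using False by (intro sum.cong) auto
    also have "\<dots> = edge_length n x u + (\<Sum>j = 1..<u. ?c j)"
      by (simp add: entry_self)
    also have "\<dots> \<le> ?D + (\<Sum>j = 1..<u. ?D * ?Y j)"
    proof (intro add_mono sum_mono)
      show "edge_length n x u \<le> ?D" using False u x by (intro edge_length_le_side) auto
      fix j assume j: "j \<in> {1..<u}"
      have m: "1 \<le> ?m j" using j by (intro grid_size_ge) auto
      show "?c j \<le> ?D * ?Y j"
      proof (cases "entry (nn_parent n x) j u = j")
        case False
        then show ?thesis using D Y[of j] by (simp add: mult_nonneg_nonneg)
      next
        case True
        then have a: "x \<in> ancestor_event n u j j" using x(1) by (simp add: ancestor_event_def)
        show ?thesis
        proof (cases "x \<in> cell_isolated n (?m j) j")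
          case in_cell: True
          have "edge_length n x j \<le> ?D * 1" using j u x edge_length_le_side[of n x j] by auto
          also have "\<dots> \<le> ?D * ?Y j" using in_cell by (intro mult_left_mono D) simp
          finally show ?thesis using True by simp
        next
          case not_cell: False
          have "edge_length n x j \<le> ?D / ?m j" by (rule edge_length_le_grid[OF n m x(1) not_cell])
          then show ?thesis using True a not_cell by simp
        qed
      qed
    qed
    also have "\<dots> = ?D * climb_bound n u x"
      unfolding climb_bound_def by (simp add: distrib_left sum_distrib_left)
    finally show ?thesis .
  qed
qed

text \<open>The stretch factor can exceed \<open>c\<close> only if the two points are close or one
  of the two climbs is long. Both the lower bound on the distance and the upper bound on the climbs
  scale with the side, so the side cancels and \<open>c\<close> does not depend on
  \<open>n\<close>.\<close>

lemma prob_stretch_factor_le: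
  fixes \<epsilon> :: real
  assumes "0 < \<epsilon>"
  shows "\<exists>c>0. \<forall>n u v. u < n \<longrightarrow> v < n \<longrightarrow> u \<noteq> v \<longrightarrow>
    1 - \<epsilon> \<le> measure (nn_points n) {x \<in> space (nn_points n :: (nat \<Rightarrow> real ^ 'd::finite) measure).
      stretch_factor n x u v \<le> c}"
proof -
  define K where "K = 1 + (\<Sum>j. climb_weight CARD('d) j)"
  have K: "1 \<le> K"
    by (simp add: K_def suminf_nonneg summable_climb_weight climb_weight_nonneg)
  \<comment> \<open>Chosen so that Markov's inequality bounds the probability of a long climb by K /
    C = \<epsilon> / 6.\<close>
  define C where "C = 6 * K / \<epsilon>"
  have C: "0 < C" using K assms by (simp add: C_def)
  \<comment> \<open>Chosen so that a distance below the mesh has probability at most 3 / m \<le>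
    \<epsilon> / 3.\<close>
  define m where "m = nat \<lceil>9 / \<epsilon>\<rceil>"
  have m9: "9 / \<epsilon> \<le> real m" unfolding m_def by linarith
  have "0 < 9 / \<epsilon>" using assms by simp
  then have m: "1 \<le> m" using m9 by (cases m) auto
  have m3: "3 / real m \<le> \<epsilon> / 3" using m9 assms m by (simp add: field_simps)
  \<comment> \<open>Two climbs of length at most d * L * C each, divided by a distance of at least L
    / m, where L is the side.\<close>
  define c where "c = 2 * real CARD('d) * C * real m"
  have "0 < c" using C m by (simp add: c_def)
  moreover have "1 - \<epsilon> \<le> measure (nn_points n) {x \<in> space (nn_points n :: (nat \<Rightarrow> real ^ 'd) measure).
      stretch_factor n x u v \<le> c}" if uv: "u < n" "v < n" "u \<noteq> v" for n u v
  proof -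
    have n: "1 \<le> n" using uv by simp
    let ?M = "nn_points n :: (nat \<Rightarrow> real ^ 'd) measure"
    let ?L = "torus_side TYPE('d) n"
    interpret P: prob_space ?M by (rule prob_space_nn_points[OF n])
    let ?near = "{x \<in> space ?M. torus_dist n (x u) (x v) < ?L / m}"
    let ?far = "\<lambda>w. {x \<in> space ?M. climb_bound n w x \<ge> C}"
    let ?S = "{x \<in> space ?M. stretch_factor n x u v \<le> c}"
    have L: "0 < ?L" by (rule torus_side_pos[OF n])
    have near: "P.prob ?near \<le> \<epsilon> / 3"
      using prob_torus_dist_less_le[OF n m uv, where ?'d = 'd] m3 by linarith
    have climb_meas [measurable]: "climb_bound n w \<in> borel_measurable ?M" for w
      using climb_bound_integrable[OF n] by (rule borel_measurable_integrable)
    have far: "P.prob (?far w) \<le> \<epsilon> / 6" if "w < n" for w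
    proof -
      have "P.prob (?far w) \<le> (\<integral>x. climb_bound n w x \<partial>?M) / C"
      proof (rule integral_Markov_inequality_measure[where A = "{}"])
        show "AE x in ?M. 0 \<le> climb_bound n w x"
          by (intro AE_I2) (auto simp: climb_bound_def intro!: add_nonneg_nonneg sum_nonneg)
      qed (use climb_bound_integrable[OF n] C in auto)
      also have "\<dots> \<le> K / C"
        using expectation_climb_bound_le[OF that, where ?'d = 'd] C by (intro divide_right_mono) (auto simp: K_def)
      also have "\<dots> = \<epsilon> / 6" using K assms by (simp add: C_def)
      finally show ?thesis .
    qed
    have near_sets [measurable]: "?near \<in> sets ?M" by measurable
    have far_sets [measurable]: "?far w \<in> sets ?M" for w by measurable
    have S_sets [measurable]: "?S \<in> sets ?M" by measurable
    have "P.prob (space ?M - ?S) \<le> P.prob (?near \<union> (?far u \<union> ?far v))"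
    proof (rule P.finite_measure_mono_AE)
      show "AE x in ?M. x \<in> space ?M - ?S \<longrightarrow> x \<in> ?near \<union> (?far u \<union> ?far v)"
        using AE_nn_points_cube[OF n]
      proof (rule AE_mp, intro AE_I2 impI)
        fix x :: "nat \<Rightarrow> real ^ 'd"
        assume x: "x \<in> space ?M" "\<forall>i<n. x i \<in> torus_cube n" "x \<in> space ?M - ?S"
        show "x \<in> ?near \<union> (?far u \<union> ?far v)"
        proof (rule ccontr)
          assume "x \<notin> ?near \<union> (?far u \<union> ?far v)"
          then have *: "?L / m \<le> torus_dist n (x u) (x v)" "climb_bound n u x \<le> C" "climb_bound n v x \<le> C"
            using x(1) by auto
          let ?D = "real CARD('d) * ?L"
          have "path_length n x (nn_path n x u v) \<le> ?D * climb_bound n u x + ?D * climb_bound n v x"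
            using nn_path_length_le[OF uv(1,2), of x] climb_le_climb_bound[OF uv(1) x(1,2)]
              climb_le_climb_bound[OF uv(2) x(1,2)] by linarith
          also have "\<dots> \<le> ?D * C + ?D * C"
            using * L by (intro add_mono mult_left_mono) auto
          also have "\<dots> = c * (?L / m)" using m by (simp add: c_def)
          also have "\<dots> \<le> c * torus_dist n (x u) (x v)"
            using * \<open>0 < c\<close> by (intro mult_left_mono) auto
          finally have "path_length n x (nn_path n x u v) \<le> c * torus_dist n (x u) (x v)" .
          moreover have "0 < ?L / m" using L m by simp
          then have "0 < torus_dist n (x u) (x v)" using *(1) by linarith
          ultimately have "stretch_factor n x u v \<le> c"
            by (simp add: stretch_factor_def pos_divide_le_eq)
          then show False using x by simp
        qed
      qed
    qed measurable
    also have "\<dots> \<le> P.prob ?near + (P.prob (?far u) + P.prob (?far v))"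
      by (intro order_trans[OF measure_Un_le] add_left_mono measure_Un_le sets.Un near_sets far_sets)
    also have "\<dots> \<le> \<epsilon>" using near far[OF uv(1)] far[OF uv(2)] assms by simp
    finally show ?thesis using P.prob_compl[OF S_sets] by simp
  qed
  ultimately show ?thesis by blast
qed

theorem corollary5p7:
  fixes \<epsilon> :: real
  assumes "0 < \<epsilon>" and "\<epsilon> < real CARD('d::finite) powr (- (real CARD('d) / 2))"
  shows "\<exists>c::real. c > 0 \<and> (\<forall>n::nat. n \<ge> 2 \<longrightarrow>
    \<P>((x, u, v) in (nn_model n :: ((nat \<Rightarrow> real ^ 'd) \<times> nat \<times> nat) measure).
        stretch_factor n x u v \<le> c) \<ge> 1 - \<epsilon>)"
proof -
  obtain c where c: "0 < c" "\<And>n u v. u < n \<Longrightarrow> v < n \<Longrightarrow> u \<noteq> v \<Longrightarrow>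
      1 - \<epsilon> \<le> measure (nn_points n) {x \<in> space (nn_points n :: (nat \<Rightarrow> real ^ 'd) measure).
        stretch_factor n x u v \<le> c}"
    using prob_stretch_factor_le[OF assms(1), where ?'d = 'd] by blast
  have "1 - \<epsilon> \<le> \<P>((x, u, v) in (nn_model n :: ((nat \<Rightarrow> real ^ 'd) \<times> nat \<times> nat) measure).
      stretch_factor n x u v \<le> c)" if "2 \<le> n" for n
  proof -
    let ?M = "nn_points n :: (nat \<Rightarrow> real ^ 'd) measure"
    let ?V = "uniform_count_measure (vertex_pairs n)"
    have n: "1 \<le> n" using that by simp
    have fin: "finite (vertex_pairs n)"
      by (rule finite_subset[of _ "{..<n} \<times> {..<n}"]) (auto simp: vertex_pairs_def)
    \<comment> \<open>With at least two vertices the set of pairs is nonempty, so the uniform law on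
      it is a probability.\<close>
    have "(0, 1) \<in> vertex_pairs n" using that by (auto simp: vertex_pairs_def)
    then interpret V: prob_space ?V using fin by (intro prob_space_uniform_count_measure) auto
    interpret P: prob_space ?M by (rule prob_space_nn_points[OF n])
    interpret PV: pair_prob_space ?M ?V by unfold_locales
    have model: "nn_model n = ?M \<Otimes>\<^sub>M ?V"
      by (simp add: nn_model_def nn_points_def torus_law_def)
    let ?A = "{\<omega> \<in> space (?M \<Otimes>\<^sub>M ?V). stretch_factor n (fst \<omega>) (fst (snd \<omega>)) (snd (snd \<omega>)) \<le> c}"
    \<comment> \<open>The pair takes countably many values, so joint measurability reduces to that
      of the stretch factor of each fixed pair.\<close>
    have "(\<lambda>uv. uv) \<in> measurable ?V (count_space UNIV)"
      by (auto simp: measurable_def sets_uniform_count_measure space_uniform_count_measure)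
    then have "snd \<in> measurable (?M \<Otimes>\<^sub>M ?V) (count_space UNIV)"
      by (rule measurable_compose[OF measurable_snd])
    moreover have "(\<lambda>\<omega>. stretch_factor n (fst \<omega>) (fst uv) (snd uv)) \<in> borel_measurable (?M \<Otimes>\<^sub>M ?V)" for uv
      by (rule measurable_compose[OF measurable_fst stretch_factor_measurable])
    ultimately have f: "(\<lambda>\<omega>. stretch_factor n (fst \<omega>) (fst (snd \<omega>)) (snd (snd \<omega>))) \<in>
        borel_measurable (?M \<Otimes>\<^sub>M ?V)"
      by (rule measurable_compose_countable[rotated])
    have A: "?A \<in> sets (?M \<Otimes>\<^sub>M ?V)" by (rule borel_measurable_le[OF f borel_measurable_const])
    have "ennreal (1 - \<epsilon>) = (\<integral>\<^sup>+uv. ennreal (1 - \<epsilon>) \<partial>?V)"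
      by (simp add: V.emeasure_space_1)
    \<comment> \<open>Fubini with the pair outermost: each section is the event for a fixed pair of
      distinct vertices, bounded below uniformly in the pair.\<close>
    also have "\<dots> \<le> (\<integral>\<^sup>+uv. emeasure ?M ((\<lambda>x. (x, uv)) -` ?A) \<partial>?V)"
    proof (rule nn_integral_mono)
      fix uv assume "uv \<in> space ?V"
      then obtain u v where uv: "uv = (u, v)" "u < n" "v < n" "u \<noteq> v" "(u, v) \<in> vertex_pairs n"
        by (auto simp: space_uniform_count_measure vertex_pairs_def)
      have "(\<lambda>x. (x, uv)) -` ?A = {x \<in> space ?M. stretch_factor n x u v \<le> c}"
        using uv by (auto simp: space_pair_measure space_uniform_count_measure)
      then show "ennreal (1 - \<epsilon>) \<le> emeasure ?M ((\<lambda>x. (x, uv)) -` ?A)"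
        using c(2)[OF uv(2-4)] by (simp add: P.emeasure_eq_measure ennreal_leI)
    qed
    also have "\<dots> = emeasure (?M \<Otimes>\<^sub>M ?V) ?A" by (rule PV.emeasure_pair_measure_alt2[OF A, symmetric])
    finally have "ennreal (1 - \<epsilon>) \<le> ennreal (measure (?M \<Otimes>\<^sub>M ?V) ?A)"
      by (simp add: PV.P.emeasure_eq_measure)
    moreover have "?A = {(x, u, v). (x, u, v) \<in> space (?M \<Otimes>\<^sub>M ?V) \<and> stretch_factor n x u v \<le> c}"
      by auto
    ultimately show ?thesis by (simp add: model)
  qed
  with c(1) show ?thesis by blast
qed

end
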